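(* Let $\mathcal{Y}$ be a measurable space and $\{Y_t\}_{t\ge 0}$ a Markov chain on $\mathcal{Y}$ with transition kernel $P$ ($P^n$ the $n$-step kernel) satisfying the standing assumptions (A1)–(A3) below. Let $H:\mathbb{R}^d\times\mathcal{Y}\to\mathbb{R}^d$, $h(w)\doteq\mathbb{E}_{y\sim d_{\mathcal{Y}}}[H(w,y)]$, and let $w_*$ be the unique fixed point of $h$. Let $w_0\in\mathbb{R}^d$ and define iterates $$w_{t+1}=w_t+\alpha_t\big(H(w_t,Y_{t+1})-w_t\big),\qquad t\ge 0,$$ with learning rates $\alpha_t=\frac{C_\alpha}{(t+3)^{\nu}}$ for some constant $C_\alpha>0$ and some $\nu\in(\frac{2}{3},1]$. Then: (i) if $\nu<1$, then for any $\zeta\in(0,\frac{3}{2}\nu-1)$, $\lim_{t\to\infty}t^{\zeta}\|w_t-w_*\|^2=0$ almost surely; (ii) if $\nu=1$, then for any $\zeta\in(0,1)$ and any $\nu_1>0$, $\lim_{t\to\infty}\exp\big(\zeta\ln^{1/(1+\nu_1)}t\big)\|w_t-w_*\|^2=0$ almost surely.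
   Context: Standing assumptions. (A1) Geometric mixing: $\{Y_t\}$ has a unique stationary distribution $d_{\mathcal{Y}}$ and there exist constants $\varrho\in[0,1)$ and $C_{A}$ such that for all $y\in\mathcal{Y}$ and all $n\ge 0$, $\int_{\mathcal{Y}}|P^n(y,y')-d_{\mathcal{Y}}(y')|\,\mathrm{d}y'\le C_A\varrho^n$ (i.e. the total variation distance between $P^n(y,\cdot)$ and $d_{\mathcal{Y}}$ decays geometrically, uniformly in $y$). (A2) Contraction: there exist $\kappa\in[0,1)$ and a norm $\|\cdot\|$ on $\mathbb{R}^d$ such that $\|h(w)-h(w')\|\le\kappa\|w-w'\|$ for all $w,w'$ (so $h$ has a unique fixed point $w_*$). (A3) Lipschitz: there exists a finite $L_h$ with $\|H(w,y)-H(w',y)\|\le L_h\|w-w'\|$ for all $w,w'\in\mathbb{R}^d$, $y\in\mathcal{Y}$, and $\sup_{y\in\mathcal{Y}}\|H(0,y)\|<\infty$. The norm $\|\cdot\|$ in the conclusion is the norm of (A2). *)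

theory Defs
  imports "HOL-Probability.Probability"
begin

text \<open>A norm on a real vector space (the norm of assumption (A2), which need not
  be the Euclidean one).\<close>
definition is_norm :: "('v::real_vector \<Rightarrow> real) \<Rightarrow> bool" where
  "is_norm N \<longleftrightarrow> (\<forall>x. 0 \<le> N x) \<and> (\<forall>x. N x = 0 \<longleftrightarrow> x = 0)
     \<and> (\<forall>c x. N (c *\<^sub>R x) = \<bar>c\<bar> * N x) \<and> (\<forall>x y. N (x + y) \<le> N x + N y)"

definition is_kernel :: "'y measure \<Rightarrow> ('y \<Rightarrow> 'y measure) \<Rightarrow> bool" where
  "is_kernel S K \<longleftrightarrow> (\<forall>y\<in>space S. prob_space (K y) \<and> sets (K y) = sets S)
     \<and> (\<forall>A\<in>sets S. (\<lambda>y. measure (K y) A) \<in> borel_measurable S)"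

primrec kernel_pow :: "('y \<Rightarrow> 'y measure) \<Rightarrow> nat \<Rightarrow> 'y \<Rightarrow> 'y set \<Rightarrow> real" where
  "kernel_pow K 0 y A = indicator A y"
| "kernel_pow K (Suc n) y A = (\<integral>y'. kernel_pow K n y' A \<partial>K y)"

definition markov_chain ::
  "'a measure \<Rightarrow> 'y measure \<Rightarrow> ('y \<Rightarrow> 'y measure) \<Rightarrow> (nat \<Rightarrow> 'a \<Rightarrow> 'y) \<Rightarrow> bool" where
  "markov_chain M S K Y \<longleftrightarrow> prob_space M \<and> is_kernel S K
     \<and> (\<forall>t. Y t \<in> measurable M S)
     \<and> (\<forall>t. \<forall>B \<in> sigma_sets (space M) (\<Union>i\<in>{..t}. {Y i -` A \<inter> space M | A. A \<in> sets S}).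
           \<forall>A \<in> sets S.
             measure M (B \<inter> {\<omega>\<in>space M. Y (Suc t) \<omega> \<in> A})
               = (\<integral>\<omega>\<in>B. measure (K (Y t \<omega>)) A \<partial>M))"

definition stationary :: "'y measure \<Rightarrow> ('y \<Rightarrow> 'y measure) \<Rightarrow> 'y measure \<Rightarrow> bool" where
  "stationary S K d \<longleftrightarrow> prob_space d \<and> sets d = sets S
     \<and> (\<forall>A\<in>sets S. measure d A = (\<integral>y. measure (K y) A \<partial>d))"

end

theory Submission
  imports Defs "HOL-Real_Asymp.Real_Asymp"
begin

text \<open>
  Average the noise \<open>\<epsilon>\<^sub>t = H(w\<^sub>t, Y\<^sub>t\<^sub>+\<^sub>1) - h(w\<^sub>t)\<close> along the step sizes,
  \<open>U\<^sub>t\<^sub>+\<^sub>1 = (1 - \<alpha>\<^sub>t) U\<^sub>t + \<alpha>\<^sub>t \<epsilon>\<^sub>t\<close>, and subtract it from the error: the remainder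
  \<open>X\<^sub>t = w\<^sub>t - w\<^sub>* - U\<^sub>t\<close> obeys the noise-free recursion
  \<open>X\<^sub>t\<^sub>+\<^sub>1 = (1 - \<alpha>\<^sub>t) X\<^sub>t + \<alpha>\<^sub>t (h(w\<^sub>t) - h(w\<^sub>*))\<close>, so that the contraction in the arbitrary norm \<open>N\<close>
  applies pathwise, whereas \<open>U\<close> is linear in the noise and is estimated in the Euclidean norm.
  The correlation of \<open>U\<^sub>t\<close> with \<open>\<epsilon>\<^sub>t\<close> is controlled by freezing the iterates about \<open>t\<^sup>1\<^sup>/\<^sup>4\<close> steps earlier
  and using geometric mixing. The Lyapunov function \<open>E N(X)\<^sup>2 + \<lambda> E|U|\<^sup>2\<close> is therefore first bounded
  and then of order \<open>t powr -r\<close>, with \<open>r = \<nu> - 1/4\<close> if \<open>\<nu> < 1\<close> and some \<open>r > 0\<close> if \<open>\<nu> = 1\<close>.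

  For the almost sure rate, the mean-square bound makes \<open>\<Sum> t powr (\<zeta> - g) * |w\<^sub>t - w\<^sub>*|\<^sup>2\<close>
  finite almost surely for \<open>g > 1 - r + \<zeta>\<close>. Over a block of length \<open>t powr g\<close> before \<open>t\<close> the iterates move
  by at most \<open>O(t powr (g - \<nu>))\<close>, so \<open>t powr \<zeta> * |w\<^sub>t - w\<^sub>*|\<^sup>2\<close> is bounded by a tail of that series plus
  \<open>O(t powr (\<zeta> + 2 g - 2 \<nu>))\<close>. An admissible \<open>g < \<nu> - \<zeta> / 2\<close> exists as soon as \<open>3 \<zeta> / 2 < \<nu> + r - 1\<close>.
\<close>

section \<open>Norms, measurability and setwise close measures\<close>

lemma is_norm_scale: "is_norm N \<Longrightarrow> N (c *\<^sub>R x) = \<bar>c\<bar> * N x"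
  by (simp add: is_norm_def)

lemma is_norm_triangle: "is_norm N \<Longrightarrow> N (x + y) \<le> N x + N y"
  by (simp add: is_norm_def)

lemma is_norm_nonneg: "is_norm N \<Longrightarrow> 0 \<le> N x"
  by (simp add: is_norm_def)

lemma is_norm_zero: "is_norm N \<Longrightarrow> N 0 = 0"
  by (simp add: is_norm_def)

lemma is_norm_minus: "is_norm N \<Longrightarrow> N (- x) = N x"
  using is_norm_scale[of N "-1" x] by simp

lemma is_norm_commute: "is_norm N \<Longrightarrow> N (x - y) = N (y - x)"
  using is_norm_minus[of N "x - y"] by simp

text \<open>Expanding in the standard basis gives the first constant and makes \<open>N\<close>
  Lipschitz, hence continuous. So \<open>N\<close> attains a minimum on the compact Euclidean unit
  sphere; it is positive, and its inverse is the second constant by homogeneity.\<close>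

lemma is_norm_equivalent:
  fixes N :: "'v::euclidean_space \<Rightarrow> real"
  assumes N: "is_norm N"
  obtains a b where "0 < a" "0 < b" "\<And>x. N x \<le> a * norm x" "\<And>x. norm x \<le> b * N x"
proof -
  define C where "C = (\<Sum>i\<in>Basis. N (i::'v)) + 1"
  have C: "0 < C"
    unfolding C_def by (intro add_nonneg_pos sum_nonneg is_norm_nonneg[OF N]) auto
  have sub: "N (\<Sum>i\<in>A. f i) \<le> (\<Sum>i\<in>A. N (f i))" if "finite A" for A and f :: "'v \<Rightarrow> 'v"
    using that
    by (induction A rule: finite_induct)
       (auto simp: is_norm_zero[OF N] intro: order_trans[OF is_norm_triangle[OF N]])
  have up: "N x \<le> C * norm x" for x
  proof -
    have "N x = N (\<Sum>i\<in>Basis. (x \<bullet> i) *\<^sub>R i)" by (simp add: euclidean_representation)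
    also have "\<dots> \<le> (\<Sum>i\<in>Basis. N ((x \<bullet> i) *\<^sub>R i))" by (rule sub) simp
    also have "\<dots> \<le> (\<Sum>i\<in>Basis. norm x * N i)"
      by (intro sum_mono) (simp add: is_norm_scale[OF N] mult_right_mono Basis_le_norm is_norm_nonneg[OF N])
    also have "\<dots> \<le> C * norm x"
      unfolding C_def sum_distrib_left[symmetric] by (simp add: algebra_simps)
    finally show ?thesis .
  qed
  have "continuous_on (sphere 0 1) N"
  proof (rule lipschitz_on_continuous_on, rule lipschitz_onI)
    fix x y :: 'v
    have "N x \<le> N y + N (x - y)" "N y \<le> N x + N (y - x)"
      using is_norm_triangle[OF N, of y "x - y"] is_norm_triangle[OF N, of x "y - x"] by auto
    with up[of "x - y"] is_norm_commute[OF N, of x y] show "dist (N x) (N y) \<le> C * dist x y"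
      by (simp add: dist_real_def dist_norm)
  qed (use C in simp)
  then obtain z where z: "z \<in> sphere 0 1" "\<And>x. x \<in> sphere 0 1 \<Longrightarrow> N z \<le> N x"
    using continuous_attains_inf[of "sphere (0::'v) 1" N] by auto
  have pos: "0 < N z"
    using z(1) N unfolding is_norm_def by (metis less_eq_real_def norm_zero mem_sphere_0 zero_neq_one)
  have lo: "norm x \<le> inverse (N z) * N x" for x
  proof (cases "x = 0")
    case False
    then have "N z \<le> N (inverse (norm x) *\<^sub>R x)" by (intro z) simp
    also have "\<dots> = inverse (norm x) * N x" by (simp add: is_norm_scale[OF N])
    finally show ?thesis using False pos by (simp add: field_simps)
  qed (simp add: is_norm_nonneg[OF N] is_norm_zero[OF N])
  show ?thesis by (rule that[OF C _ up lo]) (use pos in simp)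
qed

text \<open>\<open>H\<close> is measurable in its second argument and continuous in its first (a
  Caratheodory function). Replacing \<open>f\<close> by simple functions leaves finitely many fixed
  first arguments at a time, and continuity carries measurability to the limit.\<close>

lemma borel_measurable_caratheodory:
  fixes H :: "'v::{metric_space,second_countable_topology} \<Rightarrow> 'y \<Rightarrow> 'w::{metric_space}"
  assumes f: "f \<in> borel_measurable M" and g: "g \<in> measurable M S"
    and H: "\<And>v. H v \<in> borel_measurable S"
    and cont: "\<And>y. y \<in> space S \<Longrightarrow> continuous_on UNIV (\<lambda>v. H v y)"
  shows "(\<lambda>x. H (f x) (g x)) \<in> borel_measurable M"
proof -
  from borel_measurable_implies_sequence_metric[OF f, of undefined]
  obtain F where F: "\<And>i. simple_function M (F i)"
    "\<And>x. x \<in> space M \<Longrightarrow> (\<lambda>i. F i x) \<longlonglongrightarrow> f x"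
    by auto
  show ?thesis
  proof (rule borel_measurable_LIMSEQ_metric)
    fix i
    show "(\<lambda>x. H (F i x) (g x)) \<in> borel_measurable M"
    proof (rule measurable_compose_countable'[where f="\<lambda>v x. H v (g x)" and I="F i ` space M"])
      show "F i \<in> measurable M (count_space (F i ` space M))"
        using F(1)[of i] by (intro measurable_count_space_eq2[THEN iffD2]) (auto simp: simple_function_def)
      show "countable (F i ` space M)"
        using F(1)[of i] by (auto simp: simple_function_def intro: countable_finite)
    qed (rule measurable_compose[OF g H])
  next
    fix x assume x: "x \<in> space M"
    then have "isCont (\<lambda>v. H v (g x)) (f x)"
      using cont[of "g x"] measurable_space[OF g] by (auto simp: continuous_on_eq_continuous_at)
    from isCont_tendsto_compose[OF this F(2)[OF x]]
    show "(\<lambda>i. H (F i x) (g x)) \<longlonglongrightarrow> H (f x) (g x)" .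
  qed
qed

text \<open>Mixing is assumed set by set, while the recursion needs integrals. For a simple function
  the level sets are grouped by the sign of the difference of the two measures; each group is one
  measurable set and contributes at most \<delta>. The constant 4 is 2 for the two signs times 2 for
  the approximants, which are bounded by \<open>2 * b\<close>.\<close>

lemma integral_diff_le_of_setwise:
  assumes fin: "finite_measure \<mu>" "finite_measure \<nu>"
    and sets: "sets \<mu> = sets S" "sets \<nu> = sets S"
    and close: "\<And>A. A \<in> sets S \<Longrightarrow> \<bar>measure \<mu> A - measure \<nu> A\<bar> \<le> \<delta>"
    and f: "f \<in> borel_measurable S" and bound: "\<And>y. y \<in> space S \<Longrightarrow> \<bar>f y\<bar> \<le> (b::real)"
    and b: "0 \<le> b"
  shows "\<bar>(\<integral>y. f y \<partial>\<mu>) - (\<integral>y. f y \<partial>\<nu>)\<bar> \<le> 4 * b * \<delta>"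
proof -
  interpret \<mu>: finite_measure \<mu> by fact
  interpret \<nu>: finite_measure \<nu> by fact
  have sp: "space \<mu> = space S" "space \<nu> = space S"
    using sets[THEN sets_eq_imp_space_eq] by auto
  from borel_measurable_implies_sequence_metric[OF f, of 0]
  obtain F where F: "\<And>i. simple_function S (F i)"
    "\<And>x. x \<in> space S \<Longrightarrow> (\<lambda>i. F i x) \<longlonglongrightarrow> f x"
    "\<And>i x. x \<in> space S \<Longrightarrow> dist (F i x) 0 \<le> 2 * dist (f x) 0"
    by blast
  have Fb: "\<bar>F i x\<bar> \<le> 2 * b" if "x \<in> space S" for i x
    using F(3)[OF that, of i] bound[OF that] by (simp add: dist_real_def)
  have Fmeas: "F i \<in> borel_measurable S" for i
    using F(1) by (rule borel_measurable_simple_function)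
  have simple: "\<bar>(\<integral>y. F i y \<partial>\<mu>) - (\<integral>y. F i y \<partial>\<nu>)\<bar> \<le> 4 * b * \<delta>" for i
  proof -
    define R where "R = F i ` space S"
    have finR: "finite R" using F(1)[of i] by (auto simp: R_def simple_function_def)
    define D where "D r = F i -` {r} \<inter> space S" for r
    have D: "D r \<in> sets S" for r
      using F(1)[of i] unfolding D_def by (rule simple_functionD)
    have int: "(\<integral>y. F i y \<partial>m) = (\<Sum>r\<in>R. r * measure m (D r))"
      if "finite_measure m" "sets m = sets S" for m
    proof -
      interpret finite_measure m by fact
      have spl: "space m = space S" using that(2) by (rule sets_eq_imp_space_eq)
      have "(\<integral>y. F i y \<partial>m) = (\<integral>y. (\<Sum>r\<in>R. r * indicator (D r) y) \<partial>m)"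
      proof (rule Bochner_Integration.integral_cong[OF refl])
        fix y assume "y \<in> space m"
        then have "(\<Sum>r\<in>R. r * indicator (D r) y) = (\<Sum>r\<in>R. if r = F i y then r else 0)"
          by (intro sum.cong) (auto simp: D_def spl)
        also have "\<dots> = F i y"
          using \<open>y \<in> space m\<close> finR by (subst sum.delta) (auto simp: R_def spl)
        finally show "F i y = (\<Sum>r\<in>R. r * indicator (D r) y)" by simp
      qed
      also have "\<dots> = (\<Sum>r\<in>R. r * measure m (D r))"
        using D that(2)
        by (subst Bochner_Integration.integral_sum)
           (auto intro!: integrable_mult_right integrable_real_indicator simp: emeasure_finite less_top[symmetric] D_def
             sets.Int_space_eq2)
      finally show ?thesis .
    qed
    define d where "d r = measure \<mu> (D r) - measure \<nu> (D r)" for r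
    \<comment> \<open>The number of level sets does not enter, because their union is again a single
      set to which \<open>close\<close> applies.\<close>
    have part: "\<bar>\<Sum>r\<in>Q. d r\<bar> \<le> \<delta>" if "Q \<subseteq> R" for Q
    proof -
      have finQ: "finite Q" using that finR finite_subset by auto
      have disj: "disjoint_family_on D Q"
        by (auto simp: disjoint_family_on_def D_def)
      have "(\<Sum>r\<in>Q. measure \<mu> (D r)) = measure \<mu> (\<Union>r\<in>Q. D r)"
        using D sets finQ disj by (intro \<mu>.finite_measure_finite_Union[symmetric]) auto
      moreover have "(\<Sum>r\<in>Q. measure \<nu> (D r)) = measure \<nu> (\<Union>r\<in>Q. D r)"
        using D sets finQ disj by (intro \<nu>.finite_measure_finite_Union[symmetric]) auto
      moreover have "(\<Union>r\<in>Q. D r) \<in> sets S" using D finQ by auto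
      ultimately show ?thesis
        using close by (simp add: d_def sum_subtractf)
    qed
    have "\<bar>(\<integral>y. F i y \<partial>\<mu>) - (\<integral>y. F i y \<partial>\<nu>)\<bar> = \<bar>\<Sum>r\<in>R. r * d r\<bar>"
      by (simp add: int fin sets d_def algebra_simps sum_subtractf)
    also have "\<dots> \<le> (\<Sum>r\<in>R. 2 * b * \<bar>d r\<bar>)"
      by (rule order_trans[OF sum_abs]) (auto intro!: sum_mono mult_right_mono simp: abs_mult R_def Fb)
    also have "\<dots> = 2 * b * ((\<Sum>r\<in>{r\<in>R. 0 \<le> d r}. d r) - (\<Sum>r\<in>{r\<in>R. \<not> 0 \<le> d r}. d r))"
    proof -
      have "(\<Sum>r\<in>R. \<bar>d r\<bar>) = (\<Sum>r\<in>R. (if 0 \<le> d r then d r else 0)) - (\<Sum>r\<in>R. (if \<not> 0 \<le> d r then d r else 0))"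
        by (subst sum_subtractf[symmetric]) (auto intro!: sum.cong)
      also have "\<dots> = (\<Sum>r\<in>{r\<in>R. 0 \<le> d r}. d r) - (\<Sum>r\<in>{r\<in>R. \<not> 0 \<le> d r}. d r)"
        using finR by (simp only: sum.inter_filter)
      finally show ?thesis by (simp add: sum_distrib_left[symmetric])
    qed
    also have "\<dots> \<le> 2 * b * (\<delta> + \<delta>)"
      using part[of "{r\<in>R. 0 \<le> d r}"] part[of "{r\<in>R. \<not> 0 \<le> d r}"] b
      by (intro mult_left_mono) auto
    finally show ?thesis by simp
  qed
  have lim: "(\<lambda>i. \<integral>y. F i y \<partial>m) \<longlonglongrightarrow> (\<integral>y. f y \<partial>m)"
    if "finite_measure m" "sets m = sets S" for m
  proof -
    interpret finite_measure m by fact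
    have spl: "space m = space S" using that(2) by (rule sets_eq_imp_space_eq)
    show ?thesis
      by (rule integral_dominated_convergence[where w="\<lambda>_. 2 * b"])
         (use f Fmeas F(2) Fb in \<open>auto simp: measurable_cong_sets[OF that(2) refl] spl intro!: AE_I2\<close>)
  qed
  show ?thesis
    by (rule LIMSEQ_le_const2[OF tendsto_rabs[OF tendsto_diff[OF lim[OF fin(1) sets(1)] lim[OF fin(2) sets(2)]]]])
       (use simple in auto)
qed

section \<open>Mixing along the chain\<close>

text \<open>Packaged as a measure so that adaptedness can be stated by
  \<open>borel_measurable\<close>. Its sets are exactly the events \<open>B\<close> over which the
  Markov property in \<open>markov_chain\<close> quantifies.\<close>

definition past :: "'a measure \<Rightarrow> 'y measure \<Rightarrow> (nat \<Rightarrow> 'a \<Rightarrow> 'y) \<Rightarrow> nat \<Rightarrow> 'a measure" where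
  "past M S Y t = sigma (space M) (\<Union>i\<in>{..t}. {Y i -` A \<inter> space M | A. A \<in> sets S})"

lemma space_past [simp]: "space (past M S Y t) = space M"
  unfolding past_def by (rule space_measure_of) auto

lemma sets_past:
  "sets (past M S Y t) = sigma_sets (space M) (\<Union>i\<in>{..t}. {Y i -` A \<inter> space M | A. A \<in> sets S})"
  unfolding past_def by (rule sets_measure_of) auto

lemma sets_past_mono: "s \<le> t \<Longrightarrow> sets (past M S Y s) \<subseteq> sets (past M S Y t)"
  unfolding sets_past by (intro sigma_sets_mono') force

lemma measurable_past:
  assumes "i \<le> t" "Y i \<in> measurable M S"
  shows "Y i \<in> measurable (past M S Y t) S"
proof (rule measurableI)
  fix A assume "A \<in> sets S"
  then show "Y i -` A \<inter> space (past M S Y t) \<in> sets (past M S Y t)"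
    using assms(1) unfolding sets_past by (auto intro!: sigma_sets.Basic)
qed (use measurable_space[OF assms(2)] in auto)

lemma sets_past_subset:
  assumes "\<And>i. Y i \<in> measurable M S"
  shows "sets (past M S Y t) \<subseteq> sets M"
  unfolding sets_past by (rule sets.sigma_sets_subset) (use assms in \<open>auto dest: measurable_sets\<close>)

lemma measurable_past_mono:
  "s \<le> t \<Longrightarrow> f \<in> measurable (past M S Y s) A \<Longrightarrow> f \<in> measurable (past M S Y t) A"
  using sets_past_mono[of s t M S Y] unfolding measurable_def by auto

lemma measurable_past_imp:
  "(\<And>i. Y i \<in> measurable M S) \<Longrightarrow> f \<in> measurable (past M S Y s) A \<Longrightarrow> f \<in> measurable M A"
  using sets_past_subset[of Y M S s] unfolding measurable_def by auto

section \<open>Kernels and their iterates\<close>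

text \<open>Bridge from the setwise notion of a kernel to the Giry monad, in which integrating out
  one step of the chain is a \<open>bind\<close>.\<close>

lemma is_kernel_measurable:
  assumes "is_kernel S K"
  shows "K \<in> measurable S (subprob_algebra S)"
proof (rule measurable_subprob_algebra)
  fix y assume y: "y \<in> space S"
  then interpret prob_space "K y" using assms by (auto simp: is_kernel_def)
  show "subprob_space (K y)" by (rule subprob_space_axioms)
  show "sets (K y) = sets S" using assms y by (auto simp: is_kernel_def)
next
  fix A assume A: "A \<in> sets S"
  have "(\<lambda>y. ennreal (measure (K y) A)) \<in> borel_measurable S"
    using assms A by (auto simp: is_kernel_def)
  moreover have "emeasure (K y) A = ennreal (measure (K y) A)" if "y \<in> space S" for y
  proof -
    interpret prob_space "K y" using assms that by (auto simp: is_kernel_def)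
    show ?thesis by (rule emeasure_eq_measure)
  qed
  ultimately show "(\<lambda>y. emeasure (K y) A) \<in> borel_measurable S"
    by (simp cong: measurable_cong)
qed

lemma kernel_pow_measurable:
  assumes K: "is_kernel S K" and A: "A \<in> sets S"
  shows "(\<lambda>y. kernel_pow K n y A) \<in> borel_measurable S"
proof (induction n)
  case (Suc n)
  from measurable_compose[OF is_kernel_measurable[OF K] integral_measurable_subprob_algebra[OF Suc]]
  show ?case by simp
qed (use A in simp)

text \<open>Together with measurability this makes every integrand in \<open>kernel_pow\<close>
  integrable, so its Bochner integrals never fall back on the default value 0.\<close>

lemma kernel_pow_bounds:
  assumes K: "is_kernel S K" and A: "A \<in> sets S" and y: "y \<in> space S"
  shows "0 \<le> kernel_pow K n y A \<and> kernel_pow K n y A \<le> 1"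
  using y
proof (induction n arbitrary: y)
  case (Suc n)
  interpret prob_space "K y" using K Suc.prems by (auto simp: is_kernel_def)
  have st: "sets (K y) = sets S" using K Suc.prems by (auto simp: is_kernel_def)
  then have sp: "space (K y) = space S" by (rule sets_eq_imp_space_eq)
  have "(\<lambda>y. kernel_pow K n y A) \<in> borel_measurable (K y)"
    using kernel_pow_measurable[OF K A, of n] by (simp add: measurable_cong_sets[OF st refl])
  then have "integrable (K y) (\<lambda>y. kernel_pow K n y A)"
    using Suc.IH by (intro integrable_const_bound[where B=1]) (auto simp: sp)
  then have "(\<integral>y'. kernel_pow K n y' A \<partial>K y) \<le> 1"
    using Suc.IH sp by (intro integral_le_const) auto
  moreover have "0 \<le> (\<integral>y'. kernel_pow K n y' A \<partial>K y)"
    using Suc.IH sp by (intro integral_nonneg_AE) auto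
  ultimately show ?case by simp
qed (simp add: indicator_def)

section \<open>Markov property for integrals and mixing estimates\<close>

text \<open>The Markov property is assumed for events. It identifies the law of the next state,
  under \<open>M\<close> restricted to \<open>B\<close>, with the bind of that restriction and the
  kernel; an equality of measures then serves every nonnegative integrand.\<close>

lemma markov_step_nn_integral:
  assumes MC: "markov_chain M S K Y" and B: "B \<in> sets (past M S Y t)"
    and g: "g \<in> borel_measurable S"
  shows "(\<integral>\<^sup>+\<omega>. indicator B \<omega> * g (Y (Suc t) \<omega>) \<partial>M)
    = (\<integral>\<^sup>+\<omega>. indicator B \<omega> * (\<integral>\<^sup>+y. g y \<partial>K (Y t \<omega>)) \<partial>M)"
proof -
  interpret prob_space M using MC by (simp add: markov_chain_def)
  have K: "is_kernel S K" and Y: "\<And>t. Y t \<in> measurable M S"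
    using MC by (auto simp: markov_chain_def)
  note [measurable] = Y is_kernel_measurable[OF K]
  have BM [measurable]: "B \<in> sets M" using B sets_past_subset[of Y M S t, OF Y] by auto
  \<comment> \<open>Restricting by a density instead of conditioning avoids dividing by the
    probability of \<open>B\<close>, which may be 0.\<close>
  define MB where "MB = density M (indicator B)"
  have MB [simp]: "space MB = space M" "sets MB = sets M" by (auto simp: MB_def)
  have KY: "(\<lambda>\<omega>. K (Y t \<omega>)) \<in> measurable MB (subprob_algebra S)"
    by (subst measurable_cong_sets[OF MB(2) refl]) measurable
  have YS: "Y (Suc t) \<in> measurable MB S"
    by (subst measurable_cong_sets[OF MB(2) refl]) measurable
  have ne: "space MB \<noteq> {}" using not_empty by simp
  have eq: "distr MB S (Y (Suc t)) = MB \<bind> (\<lambda>\<omega>. K (Y t \<omega>))"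
  proof (rule measure_eqI)
    show "sets (distr MB S (Y (Suc t))) = sets (MB \<bind> (\<lambda>\<omega>. K (Y t \<omega>)))"
      using sets_bind[OF _ ne, of "\<lambda>\<omega>. K (Y t \<omega>)" S] sets_kernel[OF KY] by simp
    fix A assume "A \<in> sets (distr MB S (Y (Suc t)))"
    then have A [measurable]: "A \<in> sets S" by simp
    have emK: "emeasure (K (Y t \<omega>)) A = ennreal (measure (K (Y t \<omega>)) A)" if "\<omega> \<in> space M" for \<omega>
    proof -
      interpret k: prob_space "K (Y t \<omega>)"
        using K measurable_space[OF Y that] by (auto simp: is_kernel_def)
      show ?thesis by (rule k.emeasure_eq_measure)
    qed
    have K1: "measure (K (Y t \<omega>)) A \<le> 1" if "\<omega> \<in> space M" for \<omega>
    proof -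
      interpret k: prob_space "K (Y t \<omega>)"
        using K measurable_space[OF Y that] by (auto simp: is_kernel_def)
      show ?thesis by (rule k.prob_le_1)
    qed
    have Km: "(\<lambda>\<omega>. measure (K (Y t \<omega>)) A) \<in> borel_measurable M"
      using K A by (auto simp: is_kernel_def intro: measurable_compose[OF Y])
    have "emeasure (distr MB S (Y (Suc t))) A = emeasure MB (Y (Suc t) -` A \<inter> space M)"
      using YS by (subst emeasure_distr) auto
    also have "\<dots> = emeasure M (B \<inter> {\<omega>\<in>space M. Y (Suc t) \<omega> \<in> A})"
      unfolding MB_def using sets.sets_into_space[OF BM]
      by (subst emeasure_density) 
         (auto simp: nn_integral_indicator[symmetric] simp del: nn_integral_indicator
               intro!: nn_integral_cong split: split_indicator)
    also have "\<dots> = ennreal (measure M (B \<inter> {\<omega>\<in>space M. Y (Suc t) \<omega> \<in> A}))"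
      by (rule emeasure_eq_measure)
    also have "measure M (B \<inter> {\<omega>\<in>space M. Y (Suc t) \<omega> \<in> A}) = (\<integral>\<omega>\<in>B. measure (K (Y t \<omega>)) A \<partial>M)"
      using MC B A unfolding markov_chain_def sets_past by blast
    also have "ennreal \<dots> = (\<integral>\<^sup>+\<omega>. ennreal (indicator B \<omega> * measure (K (Y t \<omega>)) A) \<partial>M)"
      unfolding set_lebesgue_integral_def real_scaleR_def using K1 Km
      by (intro nn_integral_eq_integral[symmetric] integrable_const_bound[where B=1])
         (auto split: split_indicator)
    also have "\<dots> = (\<integral>\<^sup>+\<omega>. indicator B \<omega> * emeasure (K (Y t \<omega>)) A \<partial>M)"
      by (intro nn_integral_cong) (auto simp: emK split: split_indicator)
    also have "\<dots> = (\<integral>\<^sup>+\<omega>. emeasure (K (Y t \<omega>)) A \<partial>MB)"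
      unfolding MB_def by (subst nn_integral_density) auto
    also have "\<dots> = emeasure (MB \<bind> (\<lambda>\<omega>. K (Y t \<omega>))) A"
      using emeasure_bind[OF ne KY A] by simp
    finally show "emeasure (distr MB S (Y (Suc t))) A = emeasure (MB \<bind> (\<lambda>\<omega>. K (Y t \<omega>))) A" .
  qed
  have "(\<integral>\<^sup>+\<omega>. indicator B \<omega> * g (Y (Suc t) \<omega>) \<partial>M) = (\<integral>\<^sup>+\<omega>. g (Y (Suc t) \<omega>) \<partial>MB)"
    unfolding MB_def using g by (subst nn_integral_density) auto
  also have "\<dots> = (\<integral>\<^sup>+y. g y \<partial>distr MB S (Y (Suc t)))"
    using YS g by (subst nn_integral_distr) auto
  also have "\<dots> = (\<integral>\<^sup>+\<omega>. (\<integral>\<^sup>+y. g y \<partial>K (Y t \<omega>)) \<partial>MB)"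
    unfolding eq using nn_integral_bind[OF g KY] by simp
  also have "\<dots> = (\<integral>\<^sup>+\<omega>. indicator B \<omega> * (\<integral>\<^sup>+y. g y \<partial>K (Y t \<omega>)) \<partial>M)"
    unfolding MB_def using g by (subst nn_integral_density) auto
  finally show ?thesis .
qed

text \<open>Induction on \<open>n\<close> with varying \<open>t\<close>: \<open>B\<close> also lies
  in the past of \<open>Suc t\<close>, so the induction hypothesis is used from there, and one
  Markov step integrates out the first transition, which is the order in which
  \<open>kernel_pow\<close> recurses.\<close>

lemma markov_emeasure_kernel_pow:
  assumes MC: "markov_chain M S K Y" and A: "A \<in> sets S" and B: "B \<in> sets (past M S Y t)"
  shows "emeasure M (B \<inter> (Y (t + n) -` A \<inter> space M))
    = (\<integral>\<^sup>+\<omega>. indicator B \<omega> * ennreal (kernel_pow K n (Y t \<omega>) A) \<partial>M)"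
  using B
proof (induction n arbitrary: t)
  case 0
  interpret prob_space M using MC by (simp add: markov_chain_def)
  have Y: "\<And>t. Y t \<in> measurable M S" using MC by (auto simp: markov_chain_def)
  have "B \<in> sets M" using 0 sets_past_subset[of Y M S t, OF Y] by auto
  then have "B \<inter> (Y t -` A \<inter> space M) \<in> sets M" using measurable_sets[OF Y A] by auto
  then show ?case
    by (auto simp: nn_integral_indicator[symmetric] simp del: nn_integral_indicator
               intro!: nn_integral_cong split: split_indicator)
next
  case (Suc n)
  have K: "is_kernel S K" and Y: "\<And>t. Y t \<in> measurable M S"
    using MC by (auto simp: markov_chain_def)
  have "B \<in> sets (past M S Y (Suc t))"
    using Suc.prems sets_past_mono[of t "Suc t"] by auto
  from Suc.IH[OF this]
  have "emeasure M (B \<inter> (Y (t + Suc n) -` A \<inter> space M))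
    = (\<integral>\<^sup>+\<omega>. indicator B \<omega> * ennreal (kernel_pow K n (Y (Suc t) \<omega>) A) \<partial>M)" by simp
  also have "\<dots> = (\<integral>\<^sup>+\<omega>. indicator B \<omega> * (\<integral>\<^sup>+y. ennreal (kernel_pow K n y A) \<partial>K (Y t \<omega>)) \<partial>M)"
    using kernel_pow_measurable[OF K A]
    by (intro markov_step_nn_integral[OF MC Suc.prems, where g="\<lambda>y. ennreal (kernel_pow K n y A)"]) auto
  also have "\<dots> = (\<integral>\<^sup>+\<omega>. indicator B \<omega> * ennreal (kernel_pow K (Suc n) (Y t \<omega>) A) \<partial>M)"
  proof (rule nn_integral_cong)
    fix \<omega> assume "\<omega> \<in> space M"
    then have y: "Y t \<omega> \<in> space S" using measurable_space[OF Y] by auto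
    interpret k: prob_space "K (Y t \<omega>)" using K y by (auto simp: is_kernel_def)
    have st: "sets (K (Y t \<omega>)) = sets S" using K y by (auto simp: is_kernel_def)
    then have sp: "space (K (Y t \<omega>)) = space S" by (rule sets_eq_imp_space_eq)
    have "integrable (K (Y t \<omega>)) (\<lambda>y. kernel_pow K n y A)"
      using kernel_pow_measurable[OF K A, of n] kernel_pow_bounds[OF K A, of _ n]
      by (intro k.integrable_const_bound[where B=1]) (auto simp: sp measurable_cong_sets[OF st refl])
    then have "(\<integral>\<^sup>+y. ennreal (kernel_pow K n y A) \<partial>K (Y t \<omega>)) = ennreal (kernel_pow K (Suc n) (Y t \<omega>) A)"
      using kernel_pow_bounds[OF K A, of _ n] sp
      by (simp only: kernel_pow.simps) (auto intro!: nn_integral_eq_integral)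
    then show "indicator B \<omega> * (\<integral>\<^sup>+y. ennreal (kernel_pow K n y A) \<partial>K (Y t \<omega>))
        = indicator B \<omega> * ennreal (kernel_pow K (Suc n) (Y t \<omega>) A)" by simp
  qed
  finally show ?case .
qed

text \<open>The mixing bound is uniform in the starting state and can be integrated over
  \<open>B\<close>. The error keeps the factor \<open>measure M B\<close>, so that errors over a
  partition can later be added.\<close>

lemma markov_mixing_setwise:
  assumes MC: "markov_chain M S K Y" and A: "A \<in> sets S" and B: "B \<in> sets (past M S Y t)"
    and mix: "\<And>y. y \<in> space S \<Longrightarrow> \<bar>kernel_pow K n y A - p\<bar> \<le> \<delta>"
  shows "\<bar>measure M (B \<inter> (Y (t + n) -` A \<inter> space M)) - measure M B * p\<bar> \<le> measure M B * \<delta>"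
proof -
  interpret prob_space M using MC by (simp add: markov_chain_def)
  have K: "is_kernel S K" and Y: "\<And>t. Y t \<in> measurable M S"
    using MC by (auto simp: markov_chain_def)
  have BM: "B \<in> sets M" using B sets_past_subset[of Y M S t, OF Y] by auto
  define q where "q \<omega> = kernel_pow K n (Y t \<omega>) A" for \<omega>
  have q01: "0 \<le> q \<omega> \<and> q \<omega> \<le> 1" if "\<omega> \<in> space M" for \<omega>
    using kernel_pow_bounds[OF K A] measurable_space[OF Y that] by (auto simp: q_def)
  have [measurable]: "q \<in> borel_measurable M"
    unfolding q_def by (rule measurable_compose[OF Y kernel_pow_measurable[OF K A]])
  have intq: "integrable M (\<lambda>\<omega>. indicator B \<omega> * q \<omega>)"
    using BM q01 by (intro integrable_const_bound[where B=1]) (auto split: split_indicator)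
  have "ennreal (measure M (B \<inter> (Y (t + n) -` A \<inter> space M))) = (\<integral>\<^sup>+\<omega>. indicator B \<omega> * ennreal (q \<omega>) \<partial>M)"
    using markov_emeasure_kernel_pow[OF MC A B, of n] by (simp add: emeasure_eq_measure q_def)
  also have "\<dots> = (\<integral>\<^sup>+\<omega>. ennreal (indicator B \<omega> * q \<omega>) \<partial>M)"
    by (intro nn_integral_cong) (auto split: split_indicator)
  also have "\<dots> = ennreal (\<integral>\<omega>. indicator B \<omega> * q \<omega> \<partial>M)"
    using q01 by (intro nn_integral_eq_integral intq) (auto split: split_indicator)
  finally have "measure M (B \<inter> (Y (t + n) -` A \<inter> space M)) = (\<integral>\<omega>. indicator B \<omega> * q \<omega> \<partial>M)"
    using q01 by (subst (asm) ennreal_inj) (auto intro!: integral_nonneg_AE split: split_indicator)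
  moreover have "measure M B * p = (\<integral>\<omega>. indicator B \<omega> * p \<partial>M)"
    using BM by simp
  ultimately have "\<bar>measure M (B \<inter> (Y (t + n) -` A \<inter> space M)) - measure M B * p\<bar>
      = \<bar>\<integral>\<omega>. indicator B \<omega> * q \<omega> - indicator B \<omega> * p \<partial>M\<bar>"
    using intq BM by (subst Bochner_Integration.integral_diff) (auto simp: emeasure_eq_measure)
  also have "\<dots> \<le> (\<integral>\<omega>. indicator B \<omega> * \<delta> \<partial>M)"
    using intq BM mix measurable_space[OF Y]
    by (intro order_trans[OF integral_abs_bound] integral_mono_AE)
       (auto simp: emeasure_eq_measure q_def split: split_indicator)
  also have "\<dots> = measure M B * \<delta>" using BM by simp
  finally show ?thesis .
qed

text \<open>Two measures of equal mass are compared: the law of \<open>Y (t + n)\<close> under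
  \<open>M\<close> restricted to \<open>B\<close>, and \<open>d\<close> scaled by the probability of
  \<open>B\<close>. Their setwise distance is at most \<open>measure M B * \<delta>\<close>.\<close>

lemma markov_mixing_integral:
  assumes MC: "markov_chain M S K Y" and B: "B \<in> sets (past M S Y t)"
    and d: "prob_space d" "sets d = sets S"
    and mix: "\<And>y A. y \<in> space S \<Longrightarrow> A \<in> sets S \<Longrightarrow> \<bar>kernel_pow K n y A - measure d A\<bar> \<le> \<delta>"
    and f: "f \<in> borel_measurable S" and bound: "\<And>y. y \<in> space S \<Longrightarrow> \<bar>f y\<bar> \<le> (b::real)"
    and b: "0 \<le> b"
  shows "\<bar>\<integral>\<omega>. indicator B \<omega> * (f (Y (t + n) \<omega>) - (\<integral>y. f y \<partial>d)) \<partial>M\<bar> \<le> 4 * b * (measure M B * \<delta>)"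
proof -
  interpret prob_space M using MC by (simp add: markov_chain_def)
  interpret d: prob_space d by fact
  have Y: "\<And>t. Y t \<in> measurable M S" using MC by (auto simp: markov_chain_def)
  note [measurable] = Y f
  have BM [measurable]: "B \<in> sets M" using B sets_past_subset[of Y M S t, OF Y] by auto
  have spd: "space d = space S" using d(2) by (rule sets_eq_imp_space_eq)
  have fd [measurable]: "f \<in> borel_measurable d" using f by (simp add: measurable_cong_sets[OF d(2) refl])
  define \<mu> where "\<mu> = distr (density M (\<lambda>\<omega>. ennreal (indicator B \<omega>))) S (Y (t + n))"
  define \<nu> where "\<nu> = density d (\<lambda>_. ennreal (measure M B))"
  have em\<mu>: "emeasure \<mu> A = ennreal (measure M (B \<inter> (Y (t + n) -` A \<inter> space M)))"
    if [measurable]: "A \<in> sets S" for A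
  proof -
    have "emeasure \<mu> A = (\<integral>\<^sup>+\<omega>. ennreal (indicator B \<omega>) * indicator (Y (t + n) -` A \<inter> space M) \<omega> \<partial>M)"
      unfolding \<mu>_def by (simp add: emeasure_distr emeasure_density)
    also have "\<dots> = (\<integral>\<^sup>+\<omega>. indicator (B \<inter> (Y (t + n) -` A \<inter> space M)) \<omega> \<partial>M)"
      by (intro nn_integral_cong) (auto split: split_indicator)
    also have "\<dots> = emeasure M (B \<inter> (Y (t + n) -` A \<inter> space M))"
      by (intro nn_integral_indicator) auto
    finally show ?thesis by (simp add: emeasure_eq_measure)
  qed
  have em\<nu>: "emeasure \<nu> A = ennreal (measure M B * measure d A)" if A: "A \<in> sets S" for A
  proof -
    have [measurable]: "A \<in> sets d" using A d(2) by simp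
    show ?thesis unfolding \<nu>_def
      by (simp add: emeasure_density nn_integral_cmult d.emeasure_eq_measure ennreal_mult)
  qed
  have sets: "sets \<mu> = sets S" "sets \<nu> = sets S" using d(2) by (auto simp: \<mu>_def \<nu>_def)
  have sp: "space \<mu> = space S" "space \<nu> = space S" using sets[THEN sets_eq_imp_space_eq] by auto
  have fin: "finite_measure \<mu>" "finite_measure \<nu>"
    using em\<mu>[of "space S"] em\<nu>[of "space S"] by (auto intro!: finite_measureI simp: sp)
  have close: "\<bar>measure \<mu> A - measure \<nu> A\<bar> \<le> measure M B * \<delta>" if A: "A \<in> sets S" for A
    using markov_mixing_setwise[OF MC A B mix[OF _ A]] em\<mu>[OF A] em\<nu>[OF A]
    by (simp add: measure_def)
  have int\<mu>: "(\<integral>y. f y \<partial>\<mu>) = (\<integral>\<omega>. indicator B \<omega> * f (Y (t + n) \<omega>) \<partial>M)"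
    unfolding \<mu>_def by (simp add: integral_distr integral_density)
  have int\<nu>: "(\<integral>y. f y \<partial>\<nu>) = measure M B * (\<integral>y. f y \<partial>d)"
    unfolding \<nu>_def by (simp add: integral_density)
  have "(\<integral>\<omega>. indicator B \<omega> * (f (Y (t + n) \<omega>) - (\<integral>y. f y \<partial>d)) \<partial>M)
    = (\<integral>\<omega>. indicator B \<omega> * f (Y (t + n) \<omega>) \<partial>M) - (\<integral>\<omega>. indicator B \<omega> * (\<integral>y. f y \<partial>d) \<partial>M)"
    unfolding right_diff_distrib
  proof (rule Bochner_Integration.integral_diff)
    show "integrable M (\<lambda>\<omega>. indicator B \<omega> * f (Y (t + n) \<omega>))"
      using bound measurable_space[OF Y] b
      by (intro integrable_const_bound[where B=b]) (auto split: split_indicator)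
  qed (auto simp: emeasure_eq_measure)
  also have "\<dots> = (\<integral>y. f y \<partial>\<mu>) - (\<integral>y. f y \<partial>\<nu>)" using int\<mu> int\<nu> by simp
  also have "\<bar>\<dots>\<bar> \<le> 4 * b * (measure M B * \<delta>)"
    by (rule integral_diff_le_of_setwise[OF fin sets close f bound b])
  finally show ?thesis .
qed

text \<open>On an event where \<open>U\<close> and \<open>W\<close> are constant, the integrand is a
  bounded scalar function of \<open>Y (t + n)\<close> centred under \<open>d\<close>, so the
  previous lemma applies. Each error is proportional to the mass of its event; the errors therefore
  sum to an expectation, independent of the number of events, and survive the passage from simple
  functions to the limit. The bound \<open>b\<close> is used only for dominated convergence and is
  absent from the estimate.\<close>

lemma markov_mixing_inner:
  fixes H :: "'v::euclidean_space \<Rightarrow> 'y \<Rightarrow> 'v"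
  assumes MC: "markov_chain M S K Y"
    and d: "prob_space d" "sets d = sets S"
    and mix: "\<And>y A. y \<in> space S \<Longrightarrow> A \<in> sets S \<Longrightarrow> \<bar>kernel_pow K n y A - measure d A\<bar> \<le> \<delta>"
    and H: "\<And>v. H v \<in> borel_measurable S"
    and H_bound: "\<And>v y. y \<in> space S \<Longrightarrow> norm (H v y) \<le> L * (1 + norm v)" and L: "0 \<le> L"
    and H_cont: "\<And>y. y \<in> space S \<Longrightarrow> continuous_on UNIV (\<lambda>v. H v y)"
    and h: "\<And>v. h v = (\<integral>y. H v y \<partial>d)" and h_cont: "continuous_on UNIV h"
    and U: "U \<in> borel_measurable (past M S Y t)" "\<And>\<omega>. \<omega> \<in> space M \<Longrightarrow> norm (U \<omega>) \<le> b"
    and W: "W \<in> borel_measurable (past M S Y t)" "\<And>\<omega>. \<omega> \<in> space M \<Longrightarrow> norm (W \<omega>) \<le> b"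
  shows "\<bar>\<integral>\<omega>. U \<omega> \<bullet> (H (W \<omega>) (Y (t + n) \<omega>) - h (W \<omega>)) \<partial>M\<bar>
    \<le> 4 * L * \<delta> * (\<integral>\<omega>. norm (U \<omega>) * (1 + norm (W \<omega>)) \<partial>M)"
proof -
  interpret prob_space M using MC by (simp add: markov_chain_def)
  interpret d: prob_space d by fact
  have Y: "\<And>t. Y t \<in> measurable M S" using MC by (auto simp: markov_chain_def)
  have YS: "Y t \<omega> \<in> space S" if "\<omega> \<in> space M" for t \<omega> using measurable_space[OF Y that] .
  have spd: "space d = space S" using d(2) by (rule sets_eq_imp_space_eq)
  have Hd: "H v \<in> borel_measurable d" for v using H by (simp add: measurable_cong_sets[OF d(2) refl])
  have Hint: "integrable d (H v)" for v
    using H_bound Hd by (intro d.integrable_const_bound[where B="L * (1 + norm v)"]) (auto simp: spd)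
  have h_bound: "norm (h v) \<le> L * (1 + norm v)" for v
  proof -
    have "norm (h v) \<le> (\<integral>y. norm (H v y) \<partial>d)" unfolding h by (rule integral_norm_bound)
    also have "\<dots> \<le> L * (1 + norm v)"
      using H_bound Hint by (intro d.integral_le_const) (auto simp: spd)
    finally show ?thesis .
  qed
  have [measurable]: "h \<in> borel_measurable borel" by (rule borel_measurable_continuous_onI[OF h_cont])
  have Hc: "(\<lambda>\<omega>. H (V \<omega>) (Y (t + n) \<omega>)) \<in> borel_measurable M" if "V \<in> borel_measurable M" for V
    using that Y H H_cont by (rule borel_measurable_caratheodory)
  \<comment> \<open>Approximating the pair at once yields a single partition into level sets on
    which both components are frozen.\<close>
  define X where "X \<omega> = (U \<omega>, W \<omega>)" for \<omega>
  have "X \<in> borel_measurable (past M S Y t)"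
    unfolding X_def using U(1) W(1) by (rule borel_measurable_Pair)
  from borel_measurable_implies_sequence_metric[OF this, of 0]
  obtain F where F: "\<And>i. simple_function (past M S Y t) (F i)"
    "\<And>\<omega>. \<omega> \<in> space M \<Longrightarrow> (\<lambda>i. F i \<omega>) \<longlonglongrightarrow> X \<omega>"
    "\<And>i \<omega>. \<omega> \<in> space M \<Longrightarrow> dist (F i \<omega>) 0 \<le> 2 * dist (X \<omega>) 0"
    unfolding space_past by blast
  \<comment> \<open>The pair has norm at most \<open>2 * \<bar>b\<bar>\<close>, and its simple
    approximants at most double that.\<close>
  define c where "c = 4 * \<bar>b\<bar>"
  have Xb: "dist (X \<omega>) 0 \<le> 2 * \<bar>b\<bar>" if "\<omega> \<in> space M" for \<omega>
    using U(2)[OF that] W(2)[OF that] norm_Pair_le[of "U \<omega>" "W \<omega>"] by (simp add: X_def)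
  have Fb: "norm (fst (F i \<omega>)) \<le> c" "norm (snd (F i \<omega>)) \<le> c" if "\<omega> \<in> space M" for i \<omega>
    using F(3)[OF that, of i] Xb[OF that] norm_fst_le[of "fst (F i \<omega>)" "snd (F i \<omega>)"]
      norm_snd_le[of "snd (F i \<omega>)" "fst (F i \<omega>)"] by (auto simp: c_def)
  have Fm [measurable]: "F i \<in> borel_measurable M" for i
    using borel_measurable_simple_function[OF F(1)] by (rule measurable_past_imp[OF Y])
  have Fm1 [measurable]: "(\<lambda>\<omega>. fst (F i \<omega>)) \<in> borel_measurable M" "(\<lambda>\<omega>. snd (F i \<omega>)) \<in> borel_measurable M" for i
    using Fm[of i] by (auto simp: borel_prod[symmetric])
  have UWm [measurable]: "U \<in> borel_measurable M" "W \<in> borel_measurable M"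
    using U(1) W(1) by (auto intro: measurable_past_imp[OF Y])
  define \<psi> where "\<psi> G \<omega> = fst (G \<omega>) \<bullet> (H (snd (G \<omega>)) (Y (t + n) \<omega>) - h (snd (G \<omega>)))"
    for G :: "'a \<Rightarrow> 'v \<times> 'v" and \<omega>
  define \<phi> where "\<phi> G \<omega> = norm (fst (G \<omega>)) * (1 + norm (snd (G \<omega>)))" for G :: "'a \<Rightarrow> 'v \<times> 'v" and \<omega>
  have simple: "\<bar>\<integral>\<omega>. \<psi> (F i) \<omega> \<partial>M\<bar> \<le> 4 * L * \<delta> * (\<integral>\<omega>. \<phi> (F i) \<omega> \<partial>M)" for i
  proof -
    define R where "R = F i ` space M"
    have finR: "finite R" using F(1)[of i] by (auto simp: R_def simple_function_def)
    define D where "D r = F i -` {r} \<inter> space M" for r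
    have D: "D r \<in> sets (past M S Y t)" for r
      using simple_functionD(2)[OF F(1)[of i], of "{r}"] unfolding D_def by simp
    have DM [measurable]: "D r \<in> sets M" for r
      using D[of r] sets_past_subset[of Y M S t, OF Y] by blast
    have split: "g (F i \<omega>) \<omega> = (\<Sum>r\<in>R. indicator (D r) \<omega> * g r \<omega>)" if "\<omega> \<in> space M"
      for g :: "'v \<times> 'v \<Rightarrow> 'a \<Rightarrow> real" and \<omega>
    proof -
      have "(\<Sum>r\<in>R. indicator (D r) \<omega> * g r \<omega>) = (\<Sum>r\<in>R. if r = F i \<omega> then g r \<omega> else 0)"
        using that by (intro sum.cong) (auto simp: D_def)
      also have "\<dots> = g (F i \<omega>) \<omega>"
        using that finR by (subst sum.delta) (auto simp: R_def)
      finally show ?thesis by simp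
    qed
    define \<psi>' where "\<psi>' r \<omega> = fst r \<bullet> (H (snd r) (Y (t + n) \<omega>) - h (snd r))" for r :: "'v \<times> 'v" and \<omega>
    have f_bound: "\<bar>fst r \<bullet> H (snd r) y\<bar> \<le> norm (fst r) * (L * (1 + norm (snd r)))"
      if "y \<in> space S" for r y
      using H_bound[OF that, of "snd r"] 
      by (intro order_trans[OF Cauchy_Schwarz_ineq2] mult_left_mono) auto
    have each: "\<bar>\<integral>\<omega>. indicator (D r) \<omega> * \<psi>' r \<omega> \<partial>M\<bar>
        \<le> 4 * (norm (fst r) * (L * (1 + norm (snd r)))) * (measure M (D r) * \<delta>)" for r
    proof -
      have "fst r \<bullet> h (snd r) = (\<integral>y. fst r \<bullet> H (snd r) y \<partial>d)"
        unfolding h using Hint by simp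
      then have "\<psi>' r \<omega> = fst r \<bullet> H (snd r) (Y (t + n) \<omega>) - (\<integral>y. fst r \<bullet> H (snd r) y \<partial>d)" for \<omega>
        by (simp add: \<psi>'_def inner_diff_right)
      then have eq: "\<psi>' r = (\<lambda>\<omega>. fst r \<bullet> H (snd r) (Y (t + n) \<omega>) - (\<integral>y. fst r \<bullet> H (snd r) y \<partial>d))" by auto
      show ?thesis
        unfolding eq
      proof (rule markov_mixing_integral[OF MC D d mix])
        show "(\<lambda>y. fst r \<bullet> H (snd r) y) \<in> borel_measurable S"
          using H by (intro borel_measurable_inner borel_measurable_const)
        show "0 \<le> norm (fst r) * (L * (1 + norm (snd r)))"
          using L by (intro mult_nonneg_nonneg) auto
      qed (use f_bound in auto)
    qed
    have int\<psi>: "integrable M (\<lambda>\<omega>. indicator (D r) \<omega> * \<psi>' r \<omega>)" for r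
    proof (rule integrable_const_bound[where B="norm (fst r) * (2 * (L * (1 + norm (snd r))))"])
      show "AE \<omega> in M. norm (indicator (D r) \<omega> * \<psi>' r \<omega>) \<le> norm (fst r) * (2 * (L * (1 + norm (snd r))))"
      proof (rule AE_I2)
        fix \<omega> assume "\<omega> \<in> space M"
        then have "norm (H (snd r) (Y (t + n) \<omega>) - h (snd r)) \<le> 2 * (L * (1 + norm (snd r)))"
          using H_bound[OF YS, of \<omega> "snd r" "t + n"] h_bound[of "snd r"]
          by (intro order_trans[OF norm_triangle_ineq4]) auto
        then have "\<bar>\<psi>' r \<omega>\<bar> \<le> norm (fst r) * (2 * (L * (1 + norm (snd r))))"
          unfolding \<psi>'_def by (intro order_trans[OF Cauchy_Schwarz_ineq2] mult_left_mono) auto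
        then show "norm (indicator (D r) \<omega> * \<psi>' r \<omega>) \<le> norm (fst r) * (2 * (L * (1 + norm (snd r))))"
          using L by (auto split: split_indicator)
      qed
      show "(\<lambda>\<omega>. indicator (D r) \<omega> * \<psi>' r \<omega>) \<in> borel_measurable M"
        unfolding \<psi>'_def using Hc[of "\<lambda>_. snd r"] by simp
    qed
    have "(\<integral>\<omega>. \<psi> (F i) \<omega> \<partial>M) = (\<integral>\<omega>. (\<Sum>r\<in>R. indicator (D r) \<omega> * \<psi>' r \<omega>) \<partial>M)"
      using split[of _ \<psi>'] by (intro Bochner_Integration.integral_cong) (auto simp: \<psi>_def \<psi>'_def)
    also have "\<dots> = (\<Sum>r\<in>R. \<integral>\<omega>. indicator (D r) \<omega> * \<psi>' r \<omega> \<partial>M)"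
      by (rule Bochner_Integration.integral_sum) (rule int\<psi>)
    also have "\<bar>\<dots>\<bar> \<le> (\<Sum>r\<in>R. 4 * (norm (fst r) * (L * (1 + norm (snd r)))) * (measure M (D r) * \<delta>))"
      by (intro order_trans[OF sum_abs] sum_mono each)
    also have "\<dots> = 4 * L * \<delta> * (\<Sum>r\<in>R. (\<integral>\<omega>. indicator (D r) \<omega> * (norm (fst r) * (1 + norm (snd r))) \<partial>M))"
      by (auto simp: sum_distrib_left intro!: sum.cong)
    also have "\<dots> = 4 * L * \<delta> * (\<integral>\<omega>. (\<Sum>r\<in>R. indicator (D r) \<omega> * (norm (fst r) * (1 + norm (snd r)))) \<partial>M)"
      by (subst Bochner_Integration.integral_sum) (auto simp: emeasure_eq_measure)
    also have "\<dots> = 4 * L * \<delta> * (\<integral>\<omega>. \<phi> (F i) \<omega> \<partial>M)"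
      using split[of _ "\<lambda>r _. norm (fst r) * (1 + norm (snd r))"]
      by (intro arg_cong2[where f="(*)"] refl Bochner_Integration.integral_cong) (auto simp: \<phi>_def)
    finally show ?thesis .
  qed
  have c0: "0 \<le> c" by (simp add: c_def)
  have lim\<psi>: "(\<lambda>i. \<integral>\<omega>. \<psi> (F i) \<omega> \<partial>M) \<longlonglongrightarrow> (\<integral>\<omega>. \<psi> X \<omega> \<partial>M)"
  proof (rule integral_dominated_convergence[where w="\<lambda>_. c * (2 * (L * (1 + c)))"])
    show "\<psi> X \<in> borel_measurable M"
      unfolding \<psi>_def X_def using Hc[OF UWm(2)] by simp
    show "\<psi> (F i) \<in> borel_measurable M" for i
      unfolding \<psi>_def using Hc[OF Fm1(2)] by simp
    show "AE \<omega> in M. (\<lambda>i. \<psi> (F i) \<omega>) \<longlonglongrightarrow> \<psi> X \<omega>"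
    proof (rule AE_I2)
      fix \<omega> assume \<omega>: "\<omega> \<in> space M"
      note l1 = tendsto_fst[OF F(2)[OF \<omega>]] and l2 = tendsto_snd[OF F(2)[OF \<omega>]]
      have "(\<lambda>i. H (snd (F i \<omega>)) (Y (t + n) \<omega>)) \<longlonglongrightarrow> H (snd (X \<omega>)) (Y (t + n) \<omega>)"
        using H_cont[OF YS[OF \<omega>]] l2
        by (intro isCont_tendsto_compose[where g="\<lambda>v. H v (Y (t + n) \<omega>)"]) (auto simp: continuous_on_eq_continuous_at)
      moreover have "(\<lambda>i. h (snd (F i \<omega>))) \<longlonglongrightarrow> h (snd (X \<omega>))"
        using h_cont l2 by (intro isCont_tendsto_compose[where g=h]) (auto simp: continuous_on_eq_continuous_at)
      ultimately show "(\<lambda>i. \<psi> (F i) \<omega>) \<longlonglongrightarrow> \<psi> X \<omega>"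
        unfolding \<psi>_def using l1 by (intro tendsto_inner tendsto_diff)
    qed
    show "AE \<omega> in M. norm (\<psi> (F i) \<omega>) \<le> c * (2 * (L * (1 + c)))" for i
    proof (rule AE_I2)
      fix \<omega> assume \<omega>: "\<omega> \<in> space M"
      let ?v = "snd (F i \<omega>)"
      have "L * (1 + norm ?v) \<le> L * (1 + c)" using Fb[OF \<omega>] L by (intro mult_left_mono) auto
      then have "norm (H ?v (Y (t + n) \<omega>) - h ?v) \<le> 2 * (L * (1 + c))"
        using H_bound[OF YS[OF \<omega>], of ?v "t + n"] h_bound[of ?v]
        by (intro order_trans[OF norm_triangle_ineq4]) linarith
      then show "norm (\<psi> (F i) \<omega>) \<le> c * (2 * (L * (1 + c)))"
        unfolding \<psi>_def real_norm_def using Fb[OF \<omega>] c0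
        by (intro order_trans[OF Cauchy_Schwarz_ineq2] mult_mono) auto
    qed
  qed auto
  have lim\<phi>: "(\<lambda>i. \<integral>\<omega>. \<phi> (F i) \<omega> \<partial>M) \<longlonglongrightarrow> (\<integral>\<omega>. \<phi> X \<omega> \<partial>M)"
  proof (rule integral_dominated_convergence[where w="\<lambda>_. c * (1 + c)"])
    show "AE \<omega> in M. (\<lambda>i. \<phi> (F i) \<omega>) \<longlonglongrightarrow> \<phi> X \<omega>"
      unfolding \<phi>_def using F(2) by (intro AE_I2 tendsto_intros) auto
    show "AE \<omega> in M. norm (\<phi> (F i) \<omega>) \<le> c * (1 + c)" for i
    proof (rule AE_I2)
      fix \<omega> assume \<omega>: "\<omega> \<in> space M"
      show "norm (\<phi> (F i) \<omega>) \<le> c * (1 + c)"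
        unfolding \<phi>_def using Fb[OF \<omega>] c0 by (auto simp: abs_mult intro!: mult_mono)
    qed
  qed (auto simp: \<phi>_def X_def)
  have "\<bar>\<integral>\<omega>. \<psi> X \<omega> \<partial>M\<bar> \<le> 4 * L * \<delta> * (\<integral>\<omega>. \<phi> X \<omega> \<partial>M)"
    by (rule LIMSEQ_le[OF tendsto_rabs[OF lim\<psi>] tendsto_mult_left[OF lim\<phi>]]) (use simple in auto)
  then show ?thesis by (simp add: \<psi>_def \<phi>_def X_def)
qed

section \<open>Deterministic recursions\<close>

text \<open>The perturbation may involve a bound \<open>B\<close> of the whole history, which is not
  known in advance. Once \<open>\<delta> t\<close> is at most \<open>c\<close>, the contraction
  outweighs it for every \<open>B\<close>, so the maximum over the times up to \<open>T\<close> and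
  1 propagates forever.\<close>

lemma recursion_bounded:
  fixes z \<alpha> \<delta> :: "nat \<Rightarrow> real"
  assumes step: "\<And>t B. T \<le> t \<Longrightarrow> 1 \<le> B \<Longrightarrow> (\<And>s. s \<le> t \<Longrightarrow> z s \<le> B) \<Longrightarrow>
      z (Suc t) \<le> (1 - c * \<alpha> t) * z t + \<alpha> t * \<delta> t * B"
    and small: "\<And>t. T \<le> t \<Longrightarrow> 0 \<le> \<alpha> t \<and> c * \<alpha> t \<le> 1 \<and> \<delta> t \<le> c"
  obtains B where "1 \<le> B" "\<And>t. z t \<le> B"
proof -
  define B where "B = Max (insert 1 (z ` {..T}))"
  have B: "1 \<le> B" "\<And>s. s \<le> T \<Longrightarrow> z s \<le> B"
    unfolding B_def by (rule Max_ge; simp)+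
  have "\<forall>s\<le>t. z s \<le> B" for t
  proof (induction t)
    case (Suc t)
    show ?case
    proof (cases "T \<le> t")
      case True
      have "z (Suc t) \<le> (1 - c * \<alpha> t) * z t + \<alpha> t * \<delta> t * B"
        using Suc True B(1) by (intro step) auto
      also have "\<dots> \<le> (1 - c * \<alpha> t) * B + \<alpha> t * c * B"
        using Suc B(1) small[OF True] by (intro add_mono mult_left_mono mult_right_mono) auto
      also have "\<dots> = B" by (simp add: algebra_simps)
      finally show ?thesis using Suc by (auto simp: le_Suc_eq)
    next
      case False
      then show ?thesis using B(2) by auto
    qed
  qed (use B(2) in auto)
  then show ?thesis using that[OF B(1)] by blast
qed

text \<open>A Bernoulli-type inequality from \<open>ln (1 + u) \<le> u\<close> and
  \<open>1 + y \<le> exp y\<close>. It limits the relative loss of a power weight in one time step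
  to \<open>r / x\<close>.\<close>

lemma powr_minus_Suc_ge:
  fixes x r :: real
  assumes "0 < x" "0 \<le> r"
  shows "x powr (- r) * (1 - r / x) \<le> (x + 1) powr (- r)"
proof -
  have "1 - r / x \<le> (1 + 1 / x) powr (- r)"
  proof -
    have "ln (1 + 1 / x) \<le> 1 / x" using assms by (intro ln_add_one_self_le_self) auto
    then have "r * ln (1 + 1 / x) \<le> r / x" using mult_left_mono[OF _ assms(2)] by fastforce
    then have "1 - r / x \<le> 1 + - r * ln (1 + 1 / x)" by simp
    also have "\<dots> \<le> exp (- r * ln (1 + 1 / x))" by (rule exp_ge_add_one_self)
    also have "\<dots> = (1 + 1 / x) powr (- r)" using add_pos_pos[of 1 "1 / x"] assms by (simp add: powr_def)
    finally show ?thesis .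
  qed
  then have "x powr (- r) * (1 - r / x) \<le> x powr (- r) * (1 + 1 / x) powr (- r)"
    by (intro mult_left_mono) auto
  also have "\<dots> = (x * (1 + 1 / x)) powr (- r)" using assms by (simp add: powr_mult)
  also have "x * (1 + 1 / x) = x + 1" using assms by (simp add: field_simps)
  finally show ?thesis .
qed

text \<open>The contraction is split in two halves: one absorbs the forcing, because
  \<open>D\<close> is at least \<open>2 * C / c\<close>, and the other covers the decrease of the
  power weight, because \<open>r\<close> is at most
  \<open>c / 2 * \<alpha> t * (real t + 3)\<close>.\<close>

lemma recursion_rate:
  fixes z \<alpha> :: "nat \<Rightarrow> real"
  assumes step: "\<And>t. T \<le> t \<Longrightarrow> z (Suc t) \<le> (1 - c * \<alpha> t) * z t + C * \<alpha> t * (real t + 3) powr (- r)"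
    and \<alpha>: "\<And>t. T \<le> t \<Longrightarrow> 0 \<le> \<alpha> t \<and> c * \<alpha> t \<le> 1 \<and> r \<le> c / 2 * \<alpha> t * (real t + 3)"
    and r: "0 \<le> r" and c: "0 < c"
  obtains D where "0 \<le> D" "\<And>t. z t \<le> D * (real t + 3) powr (- r)"
proof -
  \<comment> \<open>Besides \<open>2 * C / c\<close>, \<open>D\<close> dominates the ratios at all
    times up to \<open>T\<close>, which serve as initial values.\<close>
  define D where "D = Max (insert \<bar>2 * C / c\<bar> ((\<lambda>t. z t / (real t + 3) powr (- r)) ` {..T}))"
  have D0: "\<bar>2 * C / c\<bar> \<le> D" by (simp add: D_def)
  then have D: "0 \<le> D" "2 * C / c \<le> D"
    using abs_ge_zero[of "2 * C / c"] abs_ge_self[of "2 * C / c"] by linarith+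
  have Dc: "C \<le> D * c / 2" using D(2) c by (simp add: field_simps)
  have init: "z t \<le> D * (real t + 3) powr (- r)" if "t \<le> T" for t
  proof -
    have "z t / (real t + 3) powr (- r) \<le> D" unfolding D_def using that by (intro Max_ge) auto
    then show ?thesis by (simp add: pos_divide_le_eq)
  qed
  have "z t \<le> D * (real t + 3) powr (- r)" for t
  proof (induction t)
    case (Suc t)
    show ?case
    proof (cases "T \<le> t")
      case True
      let ?x = "real t + 3"
      have "z (Suc t) \<le> (1 - c * \<alpha> t) * z t + C * \<alpha> t * ?x powr (- r)" by (rule step[OF True])
      also have "\<dots> \<le> (1 - c * \<alpha> t) * (D * ?x powr (- r)) + (D * c / 2) * \<alpha> t * ?x powr (- r)"
        using \<alpha>[OF True] Suc Dc by (intro add_mono mult_left_mono mult_right_mono) auto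
      also have "\<dots> = D * (?x powr (- r) * (1 - c / 2 * \<alpha> t))" by (simp add: field_simps)
      also have "\<dots> \<le> D * (?x powr (- r) * (1 - r / ?x))"
        using D(1) \<alpha>[OF True] by (intro mult_left_mono) (auto simp: field_simps)
      also have "\<dots> \<le> D * ((?x + 1) powr (- r))"
        using D(1) r by (intro mult_left_mono powr_minus_Suc_ge) auto
      finally show ?thesis by (simp add: add.commute add.left_commute)
    next
      case False
      then show ?thesis by (intro init) auto
    qed
  qed (use init[of 0] in simp)
  then show ?thesis using that D(1) by auto
qed

text \<open>A lag of about \<open>x powr g\<close> steps with \<open>x = real t + 3\<close>: the
  geometric term is then smaller than any power of \<open>x\<close>, and the step sizes, each of
  order \<open>x powr (- \<nu>)\<close>, add up to order \<open>x powr (g - \<nu>)\<close>.\<close>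

lemma exists_lag:
  fixes \<alpha> :: "nat \<Rightarrow> real"
  assumes \<alpha>: "\<And>t. \<alpha> t = C / (real t + 3) powr \<nu>" and C: "0 < C"
    and \<nu>: "0 < \<nu>" and \<rho>: "0 < \<rho>" "\<rho> < 1" and g: "0 < g" "g < 1"
  obtains T C' where "0 \<le> C'"
    "\<And>t. T \<le> t \<Longrightarrow> \<exists>s\<le>t. \<rho> ^ (Suc t - s) + (\<Sum>i=s..<t. \<alpha> i) \<le> C' * (real t + 3) powr (- (\<nu> - g))"
proof -
  \<comment> \<open>The second condition keeps the window in the later half of the time axis, where
    every step size is within a factor \<open>2 powr \<nu>\<close> of the scale
    \<open>C * x powr (- \<nu>)\<close>.\<close>
  have "eventually (\<lambda>x::real. \<rho> powr (x powr g) \<le> x powr (- (\<nu> - g)) \<and> x powr g \<le> x / 2) at_top"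
    using assms by (intro eventually_conj; real_asymp)
  then have "eventually (\<lambda>t::nat. \<rho> powr ((real t + 3) powr g) \<le> (real t + 3) powr (- (\<nu> - g))
      \<and> (real t + 3) powr g \<le> (real t + 3) / 2) sequentially"
    by (rule eventually_compose_filterlim) real_asymp
  then obtain T where T: "\<And>t. T \<le> t \<Longrightarrow> \<rho> powr ((real t + 3) powr g) \<le> (real t + 3) powr (- (\<nu> - g))"
      "\<And>t. T \<le> t \<Longrightarrow> (real t + 3) powr g \<le> (real t + 3) / 2"
    by (auto simp: eventually_sequentially)
  show ?thesis
  proof (rule that[of "1 + C * 2 powr \<nu>" "T + 3"])
    fix t assume t: "T + 3 \<le> t"
    let ?x = "real t + 3"
    define n where "n = nat \<lfloor>?x powr g\<rfloor>"
    have n: "real n \<le> ?x powr g" "?x powr g \<le> real n + 1"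
      by (auto simp: n_def intro: less_imp_le real_of_int_floor_add_one_ge)
    have nt: "real n \<le> ?x / 2" using n T(2)[of t] t by auto
    then have nt': "n \<le> t" using t by simp
    \<comment> \<open>The noise at time \<open>t\<close> uses \<open>Y (Suc t)\<close>, so the gap
      is \<open>n + 1\<close>; this extra step compensates for the floor in
      \<open>n\<close>.\<close>
    have "\<rho> ^ (Suc t - (t - n)) = \<rho> powr (real n + 1)"
      using nt' \<rho> by (simp add: powr_realpow[symmetric] powr_add Suc_diff_le)
    also have "\<dots> \<le> \<rho> powr (?x powr g)" using n(2) \<rho> by (intro powr_mono') auto
    also have "\<dots> \<le> ?x powr (- (\<nu> - g))" using T(1) t by auto
    finally have 1: "\<rho> ^ (Suc t - (t - n)) \<le> ?x powr (- (\<nu> - g))" .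
    have "(\<Sum>i=t-n..<t. \<alpha> i) \<le> (\<Sum>i=t-n..<t. C * 2 powr \<nu> * ?x powr (- \<nu>))"
    proof (rule sum_mono)
      fix i assume "i \<in> {t-n..<t}"
      then have "real t \<le> real i + real n" using nt' by auto
      then have le: "?x / 2 \<le> real i + 3" using nt by simp
      have "\<alpha> i \<le> C / (?x / 2) powr \<nu>"
        unfolding \<alpha> using C \<nu> le by (intro divide_left_mono powr_mono2 mult_pos_pos) auto
      also have "\<dots> = C * 2 powr \<nu> * ?x powr (- \<nu>)"
        by (simp add: powr_divide powr_minus field_simps)
      finally show "\<alpha> i \<le> C * 2 powr \<nu> * ?x powr (- \<nu>)" .
    qed
    also have "\<dots> = real n * (C * 2 powr \<nu> * ?x powr (- \<nu>))" using nt' by simp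
    also have "\<dots> \<le> ?x powr g * (C * 2 powr \<nu> * ?x powr (- \<nu>))"
      using n(1) C by (intro mult_right_mono) auto
    also have "\<dots> = C * 2 powr \<nu> * ?x powr (- (\<nu> - g))"
      by (simp add: powr_diff powr_minus field_simps)
    finally have 2: "(\<Sum>i=t-n..<t. \<alpha> i) \<le> C * 2 powr \<nu> * ?x powr (- (\<nu> - g))" .
    show "\<exists>s\<le>t. \<rho> ^ (Suc t - s) + (\<Sum>i=s..<t. \<alpha> i) \<le> (1 + C * 2 powr \<nu>) * ?x powr (- (\<nu> - g))"
      using 1 2 by (intro exI[of _ "t - n"]) (auto simp: distrib_right)
  qed (use C in simp)
qed

section \<open>From summability to pointwise rates\<close>

text \<open>Discrete Gronwall inequality; adding 1 to \<open>e\<close> makes the affine growth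
  multiplicative.\<close>

lemma growth_exp_sum:
  fixes e \<alpha> :: "nat \<Rightarrow> real"
  assumes step: "\<And>t. e (Suc t) \<le> e t + \<alpha> t * (C * (1 + e t))"
    and e: "\<And>t. 0 \<le> e t" and st: "s \<le> t"
  shows "1 + e t \<le> exp (C * (\<Sum>i=s..<t. \<alpha> i)) * (1 + e s)"
  using st
proof (induction t rule: dec_induct)
  case (step t)
  have "1 + e (Suc t) \<le> (1 + C * \<alpha> t) * (1 + e t)"
    using assms(1)[of t] by (simp add: algebra_simps)
  also have "\<dots> \<le> exp (C * \<alpha> t) * (1 + e t)"
    using e[of t] by (intro mult_right_mono exp_ge_add_one_self) auto
  also have "\<dots> \<le> exp (C * \<alpha> t) * (exp (C * (\<Sum>i=s..<t. \<alpha> i)) * (1 + e s))"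
    using step by (intro mult_left_mono) auto
  also have "\<dots> = exp (C * (\<Sum>i=s..<Suc t. \<alpha> i)) * (1 + e s)"
    using step by (simp add: distrib_left exp_add)
  finally show ?case .
qed simp

text \<open>The value at \<open>t\<close> is compared with its average over the preceding block of
  about \<open>t powr g\<close> times. Dividing by the block length produces the exponent
  \<open>- g\<close> of the series, whose block sums vanish as differences of convergent partial
  sums. The movement inside a block contributes order
  \<open>t powr (\<zeta> + 2 * g - 2 * \<nu>)\<close>, which tends to 0.\<close>

lemma weighted_summable_imp_rate:
  fixes e \<alpha> :: "nat \<Rightarrow> real"
  assumes step: "\<And>t. e (Suc t) \<le> e t + \<alpha> t * (L * (1 + e t))" and L: "0 \<le> L"
    and e: "\<And>t. 0 \<le> e t"
    and \<alpha>: "\<And>t. \<alpha> t = C / (real t + 3) powr \<nu>" and C: "0 < C"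
    and g: "0 < g" "g < \<nu>" "\<nu> \<le> 1" "\<zeta> \<le> g" "\<zeta> + 2 * g < 2 * \<nu>" and \<zeta>: "0 \<le> \<zeta>"
    and sum: "summable (\<lambda>t. (real t + 3) powr (\<zeta> - g) * (e t)\<^sup>2)"
  shows "(\<lambda>t. real t powr \<zeta> * (e t)\<^sup>2) \<longlonglongrightarrow> 0"
proof -
  define C1 where "C1 = C * 2 powr \<nu>"
  have C1: "0 < C1" using C by (simp add: C1_def)
  define n where "n t = nat \<lfloor>(real t + 3) powr g\<rfloor>" for t :: nat
  \<comment> \<open>In this order: the block covers at most half of the elapsed time, it is
    nonempty, and the Gronwall exponent over it is at most 1, so that the exponential can be
    replaced by \<open>1 + 2 * \<eta>\<close>.\<close>
  have "eventually (\<lambda>x::real. x powr g \<le> x / 2 \<and> 1 \<le> x powr g \<and> L * (C1 * x powr (g - \<nu>)) \<le> 1) at_top"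
    using g C1 L by (intro eventually_conj; real_asymp)
  then have "eventually (\<lambda>t::nat. (real t + 3) powr g \<le> (real t + 3) / 2 \<and> 1 \<le> (real t + 3) powr g
      \<and> L * (C1 * (real t + 3) powr (g - \<nu>)) \<le> 1) sequentially"
    by (rule eventually_compose_filterlim) real_asymp
  then obtain T where T: "\<And>t. T \<le> t \<Longrightarrow> (real t + 3) powr g \<le> (real t + 3) / 2"
      "\<And>t. T \<le> t \<Longrightarrow> 1 \<le> (real t + 3) powr g"
      "\<And>t. T \<le> t \<Longrightarrow> L * (C1 * (real t + 3) powr (g - \<nu>)) \<le> 1"
    by (auto simp: eventually_sequentially)
  have n: "real (n t) \<le> (real t + 3) powr g" "(real t + 3) powr g \<le> real (n t) + 1" for t
    by (auto simp: n_def intro: less_imp_le real_of_int_floor_add_one_ge)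
  define f where "f t = (real t + 3) powr (\<zeta> - g) * (e t)\<^sup>2" for t
  define S where "S t = (\<Sum>i<t. f i)" for t
  have bound: "real t powr \<zeta> * (e t)\<^sup>2
      \<le> 36 * (S t - S (t - n t)) + 8 * (L * C1)\<^sup>2 * (real t + 3) powr (\<zeta> + 2 * g - 2 * \<nu>)"
    if t: "T + 3 \<le> t" for t
  proof -
    let ?x = "real t + 3"
    define \<eta> where "\<eta> = L * (C1 * ?x powr (g - \<nu>))"
    have \<eta>: "0 \<le> \<eta>" "\<eta> \<le> 1" using L C1 T(3)[of t] t by (auto simp: \<eta>_def)
    have nt: "real (n t) \<le> ?x / 2" using n[of t] T(1)[of t] t by auto
    then have nt': "n t \<le> t" using t by simp
    have n1: "1 \<le> n t" using T(2)[of t] t by (simp add: n_def le_nat_iff)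
    \<comment> \<open>Since \<open>n t\<close> is at least 1, the floor costs at most a factor 2;
      this later turns 18 into 36.\<close>
    have xn: "?x powr g \<le> 2 * real (n t)" using n(2)[of t] n1 by linarith
    \<comment> \<open>Gronwall gives \<open>e t \<le> 3 * e s + 2 * \<eta>\<close> because \<eta> is
      at most 1; squaring a sum at the cost of a factor 2 yields 18 and 8.\<close>
    have et: "(e t)\<^sup>2 \<le> 18 * (e s)\<^sup>2 + 8 * \<eta>\<^sup>2" if s: "s \<in> {t - n t..<t}" for s
    proof -
      have "(\<Sum>i=s..<t. \<alpha> i) \<le> (\<Sum>i=s..<t. C1 * ?x powr (- \<nu>))"
      proof (rule sum_mono)
        fix i assume "i \<in> {s..<t}"
        then have "real t \<le> real i + real (n t)" using s nt' by auto
        then have le: "?x / 2 \<le> real i + 3" using nt by simp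
        have "\<alpha> i \<le> C / (?x / 2) powr \<nu>"
          unfolding \<alpha> using C g le by (intro divide_left_mono powr_mono2 mult_pos_pos) auto
        also have "\<dots> = C1 * ?x powr (- \<nu>)"
          by (simp add: powr_divide powr_minus field_simps C1_def)
        finally show "\<alpha> i \<le> C1 * ?x powr (- \<nu>)" .
      qed
      also have "\<dots> = real (t - s) * (C1 * ?x powr (- \<nu>))" by simp
      also have "\<dots> \<le> ?x powr g * (C1 * ?x powr (- \<nu>))"
      proof (rule mult_right_mono)
        have "t - s \<le> n t" using s nt' by auto
        then have "real (t - s) \<le> real (n t)" by simp
        then show "real (t - s) \<le> ?x powr g" using n(1)[of t] by linarith
      qed (use C1 in auto)
      also have "\<dots> = C1 * ?x powr (g - \<nu>)" by (simp add: powr_diff powr_minus field_simps)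
      finally have "L * (\<Sum>i=s..<t. \<alpha> i) \<le> \<eta>" unfolding \<eta>_def using L by (intro mult_left_mono) auto
      then have "exp (L * (\<Sum>i=s..<t. \<alpha> i)) \<le> exp \<eta>" by simp
      also have "\<dots> \<le> 1 + \<eta> + \<eta>\<^sup>2" using \<eta> by (rule exp_bound)
      also have "\<dots> \<le> 1 + 2 * \<eta>" using \<eta> by (simp add: power2_eq_square mult_left_le)
      finally have "exp (L * (\<Sum>i=s..<t. \<alpha> i)) * (1 + e s) \<le> (1 + 2 * \<eta>) * (1 + e s)"
        using e[of s] by (intro mult_right_mono) auto
      then have "1 + e t \<le> (1 + 2 * \<eta>) * (1 + e s)"
        using growth_exp_sum[where e=e and \<alpha>=\<alpha> and C=L and s=s and t=t, OF step e] s by simp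
      also have "\<dots> = 1 + 2 * \<eta> + (1 + 2 * \<eta>) * e s" by (simp add: algebra_simps)
      also have "(1 + 2 * \<eta>) * e s \<le> 3 * e s" using \<eta> e[of s] by (intro mult_right_mono) auto
      finally have "e t \<le> 3 * e s + 2 * \<eta>" by simp
      then have "(e t)\<^sup>2 \<le> (3 * e s + 2 * \<eta>)\<^sup>2" using e[of t] by (intro power_mono) auto
      also have "\<dots> \<le> 18 * (e s)\<^sup>2 + 8 * \<eta>\<^sup>2"
        using sum_squares_bound[of "3 * e s" "2 * \<eta>"] by (simp add: power2_eq_square algebra_simps)
      finally show ?thesis .
    qed
    have "real (n t) * (e t)\<^sup>2 = (\<Sum>s=t-n t..<t. (e t)\<^sup>2)" using nt' by simp
    also have "\<dots> \<le> (\<Sum>s=t-n t..<t. 18 * (e s)\<^sup>2 + 8 * \<eta>\<^sup>2)" by (intro sum_mono et)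
    also have "\<dots> = 18 * (\<Sum>s=t-n t..<t. (e s)\<^sup>2) + real (n t) * (8 * \<eta>\<^sup>2)"
      using nt' by (simp add: sum.distrib sum_distrib_left)
    finally have avg: "(e t)\<^sup>2 \<le> 18 * ((\<Sum>s=t-n t..<t. (e s)\<^sup>2) / real (n t)) + 8 * \<eta>\<^sup>2"
      using n1 by (simp add: field_simps)
    have "(\<Sum>s=t-n t..<t. (e s)\<^sup>2) / real (n t) \<le> (\<Sum>s=t-n t..<t. (e s)\<^sup>2) / (?x powr g / 2)"
      using xn n1 by (intro divide_left_mono sum_nonneg mult_pos_pos) auto
    with avg have avg': "(e t)\<^sup>2 \<le> 36 * ((\<Sum>s=t-n t..<t. (e s)\<^sup>2) / ?x powr g) + 8 * \<eta>\<^sup>2" by simp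
    have "real t powr \<zeta> * (e t)\<^sup>2 \<le> ?x powr \<zeta> * (e t)\<^sup>2"
      using \<zeta> by (intro mult_right_mono powr_mono2) auto
    also have "\<dots> \<le> ?x powr \<zeta> * (36 * ((\<Sum>s=t-n t..<t. (e s)\<^sup>2) / ?x powr g) + 8 * \<eta>\<^sup>2)"
      by (intro mult_left_mono avg') auto
    also have "\<dots> = 36 * (\<Sum>s=t-n t..<t. ?x powr (\<zeta> - g) * (e s)\<^sup>2) + 8 * (L * C1)\<^sup>2 * (?x powr \<zeta> * (?x powr (g - \<nu>))\<^sup>2)"
      by (simp only: sum_distrib_left[symmetric]) (simp add: \<eta>_def powr_diff field_simps power_mult_distrib)
    also have "?x powr \<zeta> * (?x powr (g - \<nu>))\<^sup>2 = ?x powr (\<zeta> + 2 * g - 2 * \<nu>)"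
      by (simp add: power2_eq_square powr_add[symmetric] algebra_simps)
    \<comment> \<open>The exponent \<open>\<zeta> - g\<close> is not positive, so the weight at
      \<open>t\<close> is at most the weight at the earlier time \<open>s\<close>.\<close>
    also have "(\<Sum>s=t-n t..<t. ?x powr (\<zeta> - g) * (e s)\<^sup>2) \<le> (\<Sum>s=t-n t..<t. f s)"
      unfolding f_def using g by (intro sum_mono mult_right_mono powr_mono2') auto
    also have "\<dots> = S t - S (t - n t)"
      unfolding S_def lessThan_atLeast0 using nt' by (simp add: sum_diff_nat_ivl)
    finally show ?thesis by simp
  qed
  \<comment> \<open>The start of the block tends to infinity as well, hence both partial sums in
    \<open>bound\<close> have the same limit.\<close>
  have lag: "filterlim (\<lambda>t. t - n t) at_top sequentially"
  proof (rule filterlim_at_top_mono[where f="\<lambda>t. t div 2 - 2"])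
    show "filterlim (\<lambda>t::nat. t div 2 - 2) at_top sequentially" 
    proof (rule filterlim_at_top[THEN iffD2], rule allI)
      fix Z :: nat show "\<forall>\<^sub>F x in sequentially. Z \<le> x div 2 - 2"
        by (rule eventually_sequentiallyI[of "2 * Z + 4"]) linarith
    qed
    show "\<forall>\<^sub>F t in sequentially. t div 2 - 2 \<le> t - n t"
    proof (rule eventually_sequentiallyI[of T])
      fix t assume "T \<le> t"
      then have "real (n t) \<le> (real t + 3) / 2" using n(1)[of t] T(1)[of t] by linarith
      then have "2 * n t \<le> t + 3" by (simp add: field_simps)
      then show "t div 2 - 2 \<le> t - n t" by linarith
    qed
  qed
  have lim: "S \<longlonglongrightarrow> suminf f"
    unfolding S_def using summable_LIMSEQ[OF sum[folded f_def]] by simp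
  have "(\<lambda>t. 36 * (S t - S (t - n t)) + 8 * (L * C1)\<^sup>2 * (real t + 3) powr (\<zeta> + 2 * g - 2 * \<nu>))
      \<longlonglongrightarrow> 36 * (suminf f - suminf f) + 8 * (L * C1)\<^sup>2 * 0"
  proof (intro tendsto_intros lim filterlim_compose[OF lim lag])
    show "(\<lambda>t. (real t + 3) powr (\<zeta> + 2 * g - 2 * \<nu>)) \<longlonglongrightarrow> 0"
      using g by real_asymp
  qed
  then have lim0: "(\<lambda>t. 36 * (S t - S (t - n t)) + 8 * (L * C1)\<^sup>2 * (real t + 3) powr (\<zeta> + 2 * g - 2 * \<nu>)) \<longlonglongrightarrow> 0"
    by simp
  show ?thesis
    by (rule tendsto_sandwich[OF _ _ tendsto_const lim0])
       (simp, rule eventually_sequentiallyI[of "T + 3"], rule bound)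
qed

text \<open>In terms of \<open>ln t\<close> this compares a power below 1 with a linear function.
  Hence in the case \<open>\<nu> = 1\<close> any positive polynomial rate, however small, is
  enough.\<close>

lemma exp_ln_powr_le_powr:
  fixes \<zeta> s \<epsilon> :: real
  assumes "s < 1" "0 < \<epsilon>"
  shows "eventually (\<lambda>t::nat. exp (\<zeta> * ln (real t) powr s) \<le> real t powr \<epsilon>) sequentially"
proof -
  have "eventually (\<lambda>x::real. \<zeta> * x powr s \<le> \<epsilon> * x) at_top"
    using assms by real_asymp
  then have "eventually (\<lambda>t::nat. \<zeta> * ln (real t) powr s \<le> \<epsilon> * ln (real t)) sequentially"
    by (rule eventually_compose_filterlim) real_asymp
  then show ?thesis
    by (rule eventually_rev_mp) (auto intro!: eventually_sequentiallyI[of 1] simp: powr_def)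
qed

text \<open>By monotone convergence the sum of the functions has a finite integral, so it is finite
  almost everywhere.\<close>

lemma AE_summable_of_integral_bound:
  fixes f :: "nat \<Rightarrow> 'a \<Rightarrow> real"
  assumes f: "\<And>t. integrable M (f t)" "\<And>t \<omega>. \<omega> \<in> space M \<Longrightarrow> 0 \<le> f t \<omega>"
    and bound: "\<And>t. (\<integral>\<omega>. f t \<omega> \<partial>M) \<le> b t" and b: "summable b"
  shows "AE \<omega> in M. summable (\<lambda>t. f t \<omega>)"
proof -
  have m: "(\<lambda>\<omega>. ennreal (f t \<omega>)) \<in> borel_measurable M" for t
    using borel_measurable_integrable[OF f(1)[of t]] by simp
  have nn: "(\<integral>\<^sup>+\<omega>. ennreal (f t \<omega>) \<partial>M) = ennreal (\<integral>\<omega>. f t \<omega> \<partial>M)" for t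
    using f by (intro nn_integral_eq_integral) auto
  have i0: "0 \<le> (\<integral>\<omega>. f t \<omega> \<partial>M)" for t using f(2) by (intro integral_nonneg_AE) auto
  have b0: "0 \<le> b t" for t using i0[of t] bound[of t] by linarith
  have "(\<integral>\<^sup>+\<omega>. (\<Sum>t. ennreal (f t \<omega>)) \<partial>M) = (\<Sum>t. ennreal (\<integral>\<omega>. f t \<omega> \<partial>M))"
    using m by (subst nn_integral_suminf) (auto simp: nn)
  also have "\<dots> \<le> (\<Sum>t. ennreal (b t))"
    using bound by (intro suminf_le) (auto intro: ennreal_leI)
  also have "\<dots> = ennreal (suminf b)" using b b0 by (intro suminf_ennreal2) auto
  finally have "(\<integral>\<^sup>+\<omega>. (\<Sum>t. ennreal (f t \<omega>)) \<partial>M) \<noteq> \<infinity>" by (auto simp: top_unique)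
  then have "AE \<omega> in M. (\<Sum>t. ennreal (f t \<omega>)) \<noteq> \<infinity>"
    using m by (intro nn_integral_PInf_AE) auto
  moreover have "AE \<omega> in M. \<omega> \<in> space M" by simp
  ultimately show ?thesis
    by eventually_elim (auto intro!: summable_suminf_not_top f(2))
qed

section \<open>Second moments of the iterates\<close>

text \<open>A certificate of integrability that is closed under the algebraic operations. For the
  iterates the bound will depend on the time; estimates uniform in time are made for moments
  only.\<close>

definition bounded_rv :: "'a measure \<Rightarrow> ('a \<Rightarrow> 'b::real_normed_vector) \<Rightarrow> bool" where
  "bounded_rv M f \<longleftrightarrow> f \<in> borel_measurable M \<and> (\<exists>b. \<forall>x\<in>space M. norm (f x) \<le> b)"

lemma bounded_rvI:
  "f \<in> borel_measurable M \<Longrightarrow> (\<And>x. x \<in> space M \<Longrightarrow> norm (f x) \<le> b) \<Longrightarrow> bounded_rv M f"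
  by (auto simp: bounded_rv_def)

lemma bounded_rv_measurable: "bounded_rv M f \<Longrightarrow> f \<in> borel_measurable M"
  by (simp add: bounded_rv_def)

lemma bounded_rvE:
  assumes "bounded_rv M f"
  obtains b where "0 \<le> b" "\<And>x. x \<in> space M \<Longrightarrow> norm (f x) \<le> b"
proof -
  from assms obtain b where "\<forall>x\<in>space M. norm (f x) \<le> b" by (auto simp: bounded_rv_def)
  then show ?thesis by (intro that[of "max 0 b"]) auto
qed

lemma bounded_rv_const: "bounded_rv M (\<lambda>_. c)"
  by (rule bounded_rvI[of _ _ "norm c"]) auto

lemma bounded_rv_norm: "bounded_rv M f \<Longrightarrow> bounded_rv M (\<lambda>x. norm (f x))"
  by (auto simp: bounded_rv_def)

lemma bounded_rv_add:
  fixes f g :: "'a \<Rightarrow> 'b::{second_countable_topology,real_normed_vector}"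
  assumes f: "bounded_rv M f" and g: "bounded_rv M g"
  shows "bounded_rv M (\<lambda>x. f x + g x)"
proof -
  obtain b where b: "\<And>x. x \<in> space M \<Longrightarrow> norm (f x) \<le> b" using bounded_rvE[OF f] by metis
  obtain c where c: "\<And>x. x \<in> space M \<Longrightarrow> norm (g x) \<le> c" using bounded_rvE[OF g] by metis
  show ?thesis
    using f[THEN bounded_rv_measurable] g[THEN bounded_rv_measurable] b c
    by (intro bounded_rvI[of _ _ "b + c"]) (auto intro: norm_triangle_mono)
qed

lemma bounded_rv_scaleR:
  fixes g :: "'a \<Rightarrow> 'b::{second_countable_topology,real_normed_vector}"
  assumes f: "bounded_rv M f" and g: "bounded_rv M g"
  shows "bounded_rv M (\<lambda>x. f x *\<^sub>R g x)"
proof -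
  obtain b where b: "0 \<le> b" "\<And>x. x \<in> space M \<Longrightarrow> norm (f x) \<le> b" using bounded_rvE[OF f] by metis
  obtain c where c: "\<And>x. x \<in> space M \<Longrightarrow> norm (g x) \<le> c" using bounded_rvE[OF g] by metis
  show ?thesis
    using f[THEN bounded_rv_measurable] g[THEN bounded_rv_measurable] b c
    by (intro bounded_rvI[of _ _ "b * c"]) (auto intro!: mult_mono)
qed

lemma bounded_rv_mult:
  fixes f g :: "'a \<Rightarrow> real"
  assumes "bounded_rv M f" "bounded_rv M g"
  shows "bounded_rv M (\<lambda>x. f x * g x)"
  using bounded_rv_scaleR[OF assms] by simp

lemma bounded_rv_diff:
  fixes f g :: "'a \<Rightarrow> 'b::{second_countable_topology,real_normed_vector}"
  assumes f: "bounded_rv M f" and g: "bounded_rv M g"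
  shows "bounded_rv M (\<lambda>x. f x - g x)"
  using bounded_rv_add[OF f bounded_rv_scaleR[OF bounded_rv_const[of M "-1"] g]] by simp

lemma bounded_rv_power2:
  fixes f :: "'a \<Rightarrow> real"
  shows "bounded_rv M f \<Longrightarrow> bounded_rv M (\<lambda>x. (f x)\<^sup>2)"
  unfolding power2_eq_square by (rule bounded_rv_mult)

lemma bounded_rv_inner:
  fixes f g :: "'a \<Rightarrow> 'b::euclidean_space"
  assumes f: "bounded_rv M f" and g: "bounded_rv M g"
  shows "bounded_rv M (\<lambda>x. f x \<bullet> g x)"
proof -
  obtain b where b: "0 \<le> b" "\<And>x. x \<in> space M \<Longrightarrow> norm (f x) \<le> b" using bounded_rvE[OF f] by metis
  obtain c where c: "\<And>x. x \<in> space M \<Longrightarrow> norm (g x) \<le> c" using bounded_rvE[OF g] by metis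
  show ?thesis
    using f[THEN bounded_rv_measurable] g[THEN bounded_rv_measurable] b c
    by (intro bounded_rvI[of _ _ "b * c"])
       (auto intro!: order_trans[OF Cauchy_Schwarz_ineq2] mult_mono)
qed

lemma bounded_rv_sum:
  fixes f :: "'i \<Rightarrow> 'a \<Rightarrow> 'b::{second_countable_topology,real_normed_vector}"
  shows "(\<And>i. i \<in> I \<Longrightarrow> bounded_rv M (f i)) \<Longrightarrow> bounded_rv M (\<lambda>x. \<Sum>i\<in>I. f i x)"
  by (induction I rule: infinite_finite_induct) (auto intro: bounded_rv_const bounded_rv_add)

lemmas bounded_rv_intros = bounded_rv_const bounded_rv_norm bounded_rv_add bounded_rv_scaleR
  bounded_rv_mult bounded_rv_diff bounded_rv_power2 bounded_rv_inner bounded_rv_sum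

lemma (in finite_measure) bounded_rv_integrable:
  fixes f :: "'a \<Rightarrow> 'b::{second_countable_topology,banach}"
  assumes "bounded_rv M f"
  shows "integrable M f"
proof -
  obtain b where "\<And>x. x \<in> space M \<Longrightarrow> norm (f x) \<le> b" using bounded_rvE[OF assms] by metis
  then show ?thesis
    using bounded_rv_measurable[OF assms] by (intro integrable_const_bound[of _ b]) auto
qed

lemma norm_telescope:
  fixes x :: "nat \<Rightarrow> 'v::real_normed_vector" and b :: "nat \<Rightarrow> real"
  assumes "\<And>i. norm (x (Suc i) - x i) \<le> b i" "s \<le> t"
  shows "norm (x t - x s) \<le> (\<Sum>i=s..<t. b i)"
proof -
  have "x t - x s = (\<Sum>i=s..<t. x (Suc i) - x i)" using sum_Suc_diff'[OF assms(2), of x] by simp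
  also have "norm \<dots> \<le> (\<Sum>i=s..<t. b i)" by (intro sum_norm_le assms)
  finally show ?thesis .
qed

text \<open>Jensen's inequality for the square. It preserves the factor \<open>1 - p\<close> of a
  contraction when the recursion is squared.\<close>

lemma convex_square:
  fixes x y p :: real
  assumes "0 \<le> p" "p \<le> 1"
  shows "((1 - p) * x + p * y)\<^sup>2 \<le> (1 - p) * x\<^sup>2 + p * y\<^sup>2"
proof -
  have "(1 - p) * x\<^sup>2 + p * y\<^sup>2 - ((1 - p) * x + p * y)\<^sup>2 = p * (1 - p) * (x - y)\<^sup>2"
    by (simp add: power2_eq_square algebra_simps)
  also have "\<dots> \<ge> 0" using assms by simp
  finally show ?thesis by simp
qed

section \<open>The iteration and its decomposition into averaged noise and remainder\<close>

text \<open>Explicit constants replace the existential assumptions. Contraction stays in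
  \<open>N\<close>, while growth and Lipschitz continuity of \<open>H\<close> are stated in the
  Euclidean norm with one common \<open>L\<close>. The base \<rho> is positive so that its natural
  powers can be compared with real powers.\<close>

locale markov_contraction =
  fixes M :: "'a measure" and S :: "'y measure" and K :: "'y \<Rightarrow> 'y measure"
    and Y :: "nat \<Rightarrow> 'a \<Rightarrow> 'y" and d :: "'y measure"
    and H :: "'v::euclidean_space \<Rightarrow> 'y \<Rightarrow> 'v" and h :: "'v \<Rightarrow> 'v" and N :: "'v \<Rightarrow> real"
    and w :: "nat \<Rightarrow> 'a \<Rightarrow> 'v" and w0 ws :: 'v and \<alpha> :: "nat \<Rightarrow> real"
    and C \<nu> \<rho> c\<^sub>A \<kappa> L n\<^sub>1 n\<^sub>2 :: real
  assumes MC: "markov_chain M S K Y"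
    and d: "prob_space d" "sets d = sets S"
    and mix: "\<And>y n A. y \<in> space S \<Longrightarrow> A \<in> sets S \<Longrightarrow> \<bar>kernel_pow K n y A - measure d A\<bar> \<le> c\<^sub>A * \<rho> ^ n"
    and \<rho>: "0 < \<rho>" "\<rho> < 1" and c\<^sub>A: "0 \<le> c\<^sub>A"
    and H_meas: "\<And>v. H v \<in> borel_measurable S"
    and h_def: "\<And>v. h v = (\<integral>y. H v y \<partial>d)"
    and N: "is_norm N" and n\<^sub>1: "\<And>x. N x \<le> n\<^sub>1 * norm x" "0 \<le> n\<^sub>1"
    and n\<^sub>2: "\<And>x. norm x \<le> n\<^sub>2 * N x" "0 \<le> n\<^sub>2"
    and contraction: "\<And>v v'. N (h v - h v') \<le> \<kappa> * N (v - v')" and \<kappa>: "0 \<le> \<kappa>" "\<kappa> < 1"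
    and H_lip: "\<And>v v' y. y \<in> space S \<Longrightarrow> norm (H v y - H v' y) \<le> L * norm (v - v')"
    and H_bound: "\<And>v y. y \<in> space S \<Longrightarrow> norm (H v y) \<le> L * (1 + norm v)" and L: "0 \<le> L"
    and fixpoint: "h ws = ws"
    and \<alpha>: "\<And>t. \<alpha> t = C / (real t + 3) powr \<nu>" and C: "0 < C" and \<nu>: "1/4 < \<nu>" "\<nu> \<le> 1"
    and w_0: "\<And>\<omega>. w 0 \<omega> = w0"
    and w_Suc: "\<And>t \<omega>. w (Suc t) \<omega> = w t \<omega> + \<alpha> t *\<^sub>R (H (w t \<omega>) (Y (Suc t) \<omega>) - w t \<omega>)"
begin

sublocale prob_space M
  using MC by (simp add: markov_chain_def)

sublocale d: prob_space d
  by (rule d(1))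

lemma Y_meas: "Y t \<in> measurable M S"
  using MC by (auto simp: markov_chain_def)

lemma Y_space: "\<omega> \<in> space M \<Longrightarrow> Y t \<omega> \<in> space S"
  using measurable_space[OF Y_meas] .

lemma \<alpha>_pos: "0 < \<alpha> t"
  using C by (simp add: \<alpha>)

lemma H_cont: "y \<in> space S \<Longrightarrow> continuous_on UNIV (\<lambda>v. H v y)"
  by (rule lipschitz_on_continuous_on[of L], rule lipschitz_onI) (use H_lip L in \<open>auto simp: dist_norm\<close>)

lemma H_integrable: "integrable d (H v)"
proof (rule d.integrable_const_bound[where B="L * (1 + norm v)"])
  show "AE y in d. norm (H v y) \<le> L * (1 + norm v)"
    using H_bound sets_eq_imp_space_eq[OF d(2)] by auto
  show "H v \<in> borel_measurable d"
    using H_meas by (simp add: measurable_cong_sets[OF d(2) refl])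
qed

lemma h_bound: "norm (h v) \<le> L * (1 + norm v)"
proof -
  have "norm (h v) \<le> (\<integral>y. norm (H v y) \<partial>d)" unfolding h_def by (rule integral_norm_bound)
  also have "\<dots> \<le> L * (1 + norm v)"
    using H_bound H_integrable sets_eq_imp_space_eq[OF d(2)] by (intro d.integral_le_const) auto
  finally show ?thesis .
qed

lemma h_lip: "norm (h v - h v') \<le> L * norm (v - v')"
proof -
  have "norm (h v - h v') = norm (\<integral>y. H v y - H v' y \<partial>d)"
    unfolding h_def using H_integrable by simp
  also have "\<dots> \<le> (\<integral>y. norm (H v y - H v' y) \<partial>d)" by (rule integral_norm_bound)
  also have "\<dots> \<le> L * norm (v - v')"
    using H_lip H_integrable sets_eq_imp_space_eq[OF d(2)] by (intro d.integral_le_const) auto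
  finally show ?thesis .
qed

lemma h_cont: "continuous_on UNIV h"
  by (rule lipschitz_on_continuous_on[of L], rule lipschitz_onI) (use h_lip L in \<open>auto simp: dist_norm\<close>)

definition noise :: "nat \<Rightarrow> 'a \<Rightarrow> 'v" where
  "noise t \<omega> = H (w t \<omega>) (Y (Suc t) \<omega>) - h (w t \<omega>)"

primrec U :: "nat \<Rightarrow> 'a \<Rightarrow> 'v" where
  "U 0 \<omega> = 0"
| "U (Suc t) \<omega> = (1 - \<alpha> t) *\<^sub>R U t \<omega> + \<alpha> t *\<^sub>R noise t \<omega>"

definition X :: "nat \<Rightarrow> 'a \<Rightarrow> 'v" where
  "X t \<omega> = w t \<omega> - ws - U t \<omega>"

text \<open>A common scale: the noise and the increments of \<open>w\<close> and \<open>U\<close>,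
  relative to the step size, are all at most a constant times \<open>V\<close>.\<close>

definition V :: "nat \<Rightarrow> 'a \<Rightarrow> real" where
  "V t \<omega> = 1 + norm (w t \<omega>) + norm (U t \<omega>)"

lemma V_ge: "1 \<le> V t \<omega>" "norm (U t \<omega>) \<le> V t \<omega>" "norm (w t \<omega>) \<le> V t \<omega>" "1 + norm (w t \<omega>) \<le> V t \<omega>"
  by (auto simp: V_def)

text \<open>\<open>w\<close> and \<open>U\<close> receive the noise with the same weight, so it
  cancels in the difference, and \<open>h ws = ws\<close> centres what remains.\<close>

lemma X_Suc: "X (Suc t) \<omega> = (1 - \<alpha> t) *\<^sub>R X t \<omega> + \<alpha> t *\<^sub>R (h (w t \<omega>) - h ws)"
  by (simp add: X_def w_Suc noise_def fixpoint algebra_simps)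

lemma noise_bound: "\<omega> \<in> space M \<Longrightarrow> norm (noise t \<omega>) \<le> (2 * L + 1) * V t \<omega>"
proof -
  assume \<omega>: "\<omega> \<in> space M"
  have "norm (noise t \<omega>) \<le> 2 * (L * (1 + norm (w t \<omega>)))"
    using norm_triangle_ineq4[of "H (w t \<omega>) (Y (Suc t) \<omega>)" "h (w t \<omega>)"]
      H_bound[OF Y_space[OF \<omega>], of "w t \<omega>" "Suc t"] h_bound[of "w t \<omega>"]
    unfolding noise_def by linarith
  also have "\<dots> \<le> 2 * (L * V t \<omega>)" using V_ge L by (intro mult_left_mono) auto
  also have "\<dots> \<le> (2 * L + 1) * V t \<omega>" using V_ge(1)[of t \<omega>] by (simp add: algebra_simps)
  finally show ?thesis .
qed

lemma w_increment: "\<omega> \<in> space M \<Longrightarrow> norm (w (Suc t) \<omega> - w t \<omega>) \<le> \<alpha> t * ((2 * L + 1) * V t \<omega>)"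
proof -
  assume \<omega>: "\<omega> \<in> space M"
  have "norm (H (w t \<omega>) (Y (Suc t) \<omega>) - w t \<omega>) \<le> L * (1 + norm (w t \<omega>)) + norm (w t \<omega>)"
    using norm_triangle_ineq4[of "H (w t \<omega>) (Y (Suc t) \<omega>)" "w t \<omega>"]
      H_bound[OF Y_space[OF \<omega>], of "w t \<omega>" "Suc t"] by linarith
  also have "\<dots> \<le> 2 * L * V t \<omega> + V t \<omega>"
    using V_ge[of t \<omega>] L by (intro add_mono mult_mono) auto
  finally show ?thesis
    using \<alpha>_pos[of t] by (simp add: w_Suc distrib_right)
qed

lemma U_increment: "\<omega> \<in> space M \<Longrightarrow> norm (U (Suc t) \<omega> - U t \<omega>) \<le> \<alpha> t * ((2 * L + 2) * V t \<omega>)"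
proof -
  assume \<omega>: "\<omega> \<in> space M"
  have "U (Suc t) \<omega> - U t \<omega> = \<alpha> t *\<^sub>R (noise t \<omega> - U t \<omega>)" by (simp add: algebra_simps)
  moreover have "norm (noise t \<omega> - U t \<omega>) \<le> (2 * L + 1) * V t \<omega> + V t \<omega>"
    using norm_triangle_ineq4[of "noise t \<omega>" "U t \<omega>"] noise_bound[OF \<omega>, of t] V_ge[of t \<omega>] by linarith
  moreover have "(2 * L + 1) * V t \<omega> + V t \<omega> = (2 * L + 2) * V t \<omega>" by (simp add: algebra_simps)
  ultimately show ?thesis using \<alpha>_pos[of t] by simp
qed

text \<open>Adaptedness: time \<open>t\<close> involves only the states up to \<open>Y t\<close>.
  This is what allows the iterates at a time \<open>s\<close> to be frozen in the mixing
  estimate.\<close>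

lemma past_measurable:
  "w t \<in> borel_measurable (past M S Y t) \<and> U t \<in> borel_measurable (past M S Y t)"
proof (induction t)
  case 0
  have "w 0 = (\<lambda>_. w0)" "U 0 = (\<lambda>_. 0)" using w_0 by auto
  then show ?case by simp
next
  case (Suc t)
  let ?P = "past M S Y (Suc t)"
  have w [measurable]: "w t \<in> borel_measurable ?P" and U [measurable]: "U t \<in> borel_measurable ?P"
    using Suc measurable_past_mono[of t "Suc t"] by auto
  have [measurable]: "(\<lambda>\<omega>. H (w t \<omega>) (Y (Suc t) \<omega>)) \<in> borel_measurable ?P"
    by (rule borel_measurable_caratheodory[OF w measurable_past[OF _ Y_meas] H_meas H_cont]) auto
  have [measurable]: "h \<in> borel_measurable borel" by (rule borel_measurable_continuous_onI[OF h_cont])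
  have eq: "w (Suc t) = (\<lambda>\<omega>. w t \<omega> + \<alpha> t *\<^sub>R (H (w t \<omega>) (Y (Suc t) \<omega>) - w t \<omega>))"
    "U (Suc t) = (\<lambda>\<omega>. (1 - \<alpha> t) *\<^sub>R U t \<omega> + \<alpha> t *\<^sub>R (H (w t \<omega>) (Y (Suc t) \<omega>) - h (w t \<omega>)))"
    using w_Suc by (auto simp: noise_def)
  show ?case unfolding eq by measurable
qed

text \<open>The start is deterministic and each increment is bounded by a multiple of
  \<open>V t\<close>, so boundedness propagates, with a constant that may grow with
  \<open>t\<close>.\<close>

lemma bounded_rv_iterates: "bounded_rv M (w t) \<and> bounded_rv M (U t)"
proof (induction t)
  case 0
  have "w 0 = (\<lambda>_. w0)" "U 0 = (\<lambda>_. 0)" using w_0 by auto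
  then show ?case by (auto intro: bounded_rv_const)
next
  case (Suc t)
  then have "bounded_rv M (V t)" unfolding V_def[abs_def] by (intro bounded_rv_intros) auto
  then obtain b where b: "\<And>\<omega>. \<omega> \<in> space M \<Longrightarrow> norm (V t \<omega>) \<le> b" using bounded_rvE by metis
  have meas: "w i \<in> borel_measurable M" "U i \<in> borel_measurable M" for i
    using past_measurable[of i] by (auto intro: measurable_past_imp[OF Y_meas])
  have Vb: "V t \<omega> \<le> b" if "\<omega> \<in> space M" for \<omega> using b[OF that] by simp
  let ?G = "2 * L + 2"
  have "bounded_rv M (\<lambda>\<omega>. w (Suc t) \<omega> - w t \<omega>)"
  proof (rule bounded_rvI[where b="\<alpha> t * (?G * b)"])
    fix \<omega> assume \<omega>: "\<omega> \<in> space M"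
    have "(2 * L + 1) * V t \<omega> \<le> ?G * b" using L Vb[OF \<omega>] V_ge(1)[of t \<omega>] by (intro mult_mono) auto
    then show "norm (w (Suc t) \<omega> - w t \<omega>) \<le> \<alpha> t * (?G * b)"
      using w_increment[OF \<omega>, of t] \<alpha>_pos[of t] by (meson mult_left_mono less_imp_le order_trans)
  qed (rule borel_measurable_diff[OF meas(1) meas(1)])
  moreover have "bounded_rv M (\<lambda>\<omega>. U (Suc t) \<omega> - U t \<omega>)"
  proof (rule bounded_rvI[where b="\<alpha> t * (?G * b)"])
    fix \<omega> assume \<omega>: "\<omega> \<in> space M"
    have "?G * V t \<omega> \<le> ?G * b" using L Vb[OF \<omega>] by (intro mult_left_mono) auto
    then show "norm (U (Suc t) \<omega> - U t \<omega>) \<le> \<alpha> t * (?G * b)"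
      using U_increment[OF \<omega>, of t] \<alpha>_pos[of t] by (meson mult_left_mono less_imp_le order_trans)
  qed (rule borel_measurable_diff[OF meas(2) meas(2)])
  ultimately show ?case
    using Suc bounded_rv_add[of M "w t" "\<lambda>\<omega>. w (Suc t) \<omega> - w t \<omega>"]
      bounded_rv_add[of M "U t" "\<lambda>\<omega>. U (Suc t) \<omega> - U t \<omega>"] by simp
qed

lemma bounded_rv_w: "bounded_rv M (w t)" and bounded_rv_U: "bounded_rv M (U t)"
  using bounded_rv_iterates by auto

lemma bounded_rv_X: "bounded_rv M (\<lambda>\<omega>. X t \<omega>)"
  unfolding X_def by (intro bounded_rv_intros bounded_rv_w bounded_rv_U)

lemma bounded_rv_V: "bounded_rv M (\<lambda>\<omega>. V t \<omega>)"
  unfolding V_def by (intro bounded_rv_intros bounded_rv_w bounded_rv_U)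

lemma bounded_rv_hw: "bounded_rv M (\<lambda>\<omega>. h (w t \<omega>))"
proof -
  obtain b where b: "\<And>\<omega>. \<omega> \<in> space M \<Longrightarrow> norm (w t \<omega>) \<le> b" using bounded_rvE[OF bounded_rv_w] by metis
  show ?thesis
  proof (rule bounded_rvI[where b="L * (1 + b)"])
    show "(\<lambda>\<omega>. h (w t \<omega>)) \<in> borel_measurable M"
      using bounded_rv_measurable[OF bounded_rv_w]
      by (rule measurable_compose) (rule borel_measurable_continuous_onI[OF h_cont])
    fix \<omega> assume "\<omega> \<in> space M"
    then have "L * (1 + norm (w t \<omega>)) \<le> L * (1 + b)" using b L by (intro mult_left_mono) auto
    then show "norm (h (w t \<omega>)) \<le> L * (1 + b)" using h_bound[of "w t \<omega>"] by linarith
  qed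
qed

lemma bounded_rv_H: "bounded_rv M (\<lambda>\<omega>. H (w t \<omega>) (Y s \<omega>))"
proof -
  obtain b where b: "\<And>\<omega>. \<omega> \<in> space M \<Longrightarrow> norm (w t \<omega>) \<le> b" using bounded_rvE[OF bounded_rv_w] by metis
  show ?thesis
  proof (rule bounded_rvI[where b="L * (1 + b)"])
    show "(\<lambda>\<omega>. H (w t \<omega>) (Y s \<omega>)) \<in> borel_measurable M"
      by (rule borel_measurable_caratheodory[OF bounded_rv_measurable[OF bounded_rv_w] Y_meas H_meas H_cont])
    fix \<omega> assume \<omega>: "\<omega> \<in> space M"
    then have "L * (1 + norm (w t \<omega>)) \<le> L * (1 + b)" using b L by (intro mult_left_mono) auto
    then show "norm (H (w t \<omega>) (Y s \<omega>)) \<le> L * (1 + b)"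
      using H_bound[OF Y_space[OF \<omega>], of "w t \<omega>" s] by linarith
  qed
qed

lemma bounded_rv_noise: "bounded_rv M (\<lambda>\<omega>. noise t \<omega>)"
  unfolding noise_def by (intro bounded_rv_intros bounded_rv_H bounded_rv_hw)

lemma bounded_rv_N:
  assumes "bounded_rv M (f :: 'a \<Rightarrow> 'v)"
  shows "bounded_rv M (\<lambda>\<omega>. N (f \<omega>))"
proof -
  obtain b where b: "\<And>\<omega>. \<omega> \<in> space M \<Longrightarrow> norm (f \<omega>) \<le> b" using bounded_rvE[OF assms] by metis
  have "continuous_on UNIV N"
  proof (rule lipschitz_on_continuous_on, rule lipschitz_onI)
    fix x y :: 'v
    have "N x \<le> N y + N (x - y)" "N y \<le> N x + N (y - x)"
      using is_norm_triangle[OF N, of y "x - y"] is_norm_triangle[OF N, of x "y - x"] by auto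
    with n\<^sub>1(1)[of "x - y"] is_norm_commute[OF N, of x y] show "dist (N x) (N y) \<le> n\<^sub>1 * dist x y"
      by (simp add: dist_real_def dist_norm)
  qed (rule n\<^sub>1)
  note meas = measurable_compose[OF bounded_rv_measurable[OF assms] borel_measurable_continuous_onI[OF this]]
  show ?thesis
  proof (rule bounded_rvI[OF meas, where b="n\<^sub>1 * b"])
    fix \<omega> assume "\<omega> \<in> space M"
    then have "n\<^sub>1 * norm (f \<omega>) \<le> n\<^sub>1 * b" using b n\<^sub>1(2) by (intro mult_left_mono) auto
    then show "norm (N (f \<omega>)) \<le> n\<^sub>1 * b"
      using n\<^sub>1(1)[of "f \<omega>"] is_norm_nonneg[OF N, of "f \<omega>"] by simp
  qed
qed

lemmas rv_intros = bounded_rv_intros bounded_rv_w bounded_rv_U bounded_rv_X bounded_rv_V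
  bounded_rv_hw bounded_rv_H bounded_rv_noise bounded_rv_N

lemma expectation_mono:
  fixes f g :: "'a \<Rightarrow> real"
  assumes "bounded_rv M f" "bounded_rv M g" "\<And>\<omega>. \<omega> \<in> space M \<Longrightarrow> f \<omega> \<le> g \<omega>"
  shows "expectation f \<le> expectation g"
  by (rule integral_mono[OF bounded_rv_integrable[OF assms(1)] bounded_rv_integrable[OF assms(2)] assms(3)])

section \<open>The Lyapunov function and the moments it controls\<close>

text \<open>The coefficient left in front of \<open>U\<close> by Jensen's inequality in
  \<open>X_step\<close>; the factor \<open>n\<^sub>1\<^sup>2\<close> passes from \<open>N\<close> to
  the Euclidean norm.\<close>

definition k\<^sub>X :: real where "k\<^sub>X = \<kappa>\<^sup>2 / (1 - \<kappa>) * n\<^sub>1\<^sup>2"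

lemma k\<^sub>X_nonneg: "0 \<le> k\<^sub>X"
  using \<kappa> by (simp add: k\<^sub>X_def)

text \<open>Pathwise, \<open>N (X (Suc t) \<omega>)\<close> is at most a convex combination of
  \<open>N (X t \<omega>)\<close> and \<open>\<kappa> / (1 - \<kappa>) * N (U t \<omega>)\<close>
  with weight \<open>(1 - \<kappa>) * \<alpha> t\<close> on the latter. Jensen's inequality then
  avoids any mixed term.\<close>

lemma X_step:
  assumes "\<alpha> t \<le> 1"
  shows "(N (X (Suc t) \<omega>))\<^sup>2 \<le> (1 - (1 - \<kappa>) * \<alpha> t) * (N (X t \<omega>))\<^sup>2 + \<alpha> t * k\<^sub>X * (norm (U t \<omega>))\<^sup>2"
proof -
  let ?p = "(1 - \<kappa>) * \<alpha> t" and ?y = "\<kappa> / (1 - \<kappa>) * N (U t \<omega>)"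
  have a: "0 \<le> \<alpha> t" using \<alpha>_pos[of t] by simp
  have p: "0 \<le> ?p" "?p \<le> 1" using \<kappa> a assms by (auto intro: mult_le_one)
  have "w t \<omega> - ws = X t \<omega> + U t \<omega>" by (simp add: X_def)
  then have e: "N (w t \<omega> - ws) \<le> N (X t \<omega>) + N (U t \<omega>)" using is_norm_triangle[OF N] by metis
  have "N (X (Suc t) \<omega>) \<le> (1 - \<alpha> t) * N (X t \<omega>) + \<alpha> t * N (h (w t \<omega>) - h ws)"
    unfolding X_Suc using a assms
    by (intro order_trans[OF is_norm_triangle[OF N]]) (simp add: is_norm_scale[OF N])
  also have "\<dots> \<le> (1 - \<alpha> t) * N (X t \<omega>) + \<alpha> t * (\<kappa> * (N (X t \<omega>) + N (U t \<omega>)))"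
    using contraction[of "w t \<omega>" ws] mult_left_mono[OF e \<kappa>(1)] a by (intro add_left_mono mult_left_mono) auto
  also have "\<dots> = (1 - ?p) * N (X t \<omega>) + ?p * ?y"
    using \<kappa> by (simp add: field_simps)
  finally have "(N (X (Suc t) \<omega>))\<^sup>2 \<le> ((1 - ?p) * N (X t \<omega>) + ?p * ?y)\<^sup>2"
    using is_norm_nonneg[OF N] by (intro power_mono) auto
  also have "\<dots> \<le> (1 - ?p) * (N (X t \<omega>))\<^sup>2 + ?p * ?y\<^sup>2"
    by (rule convex_square[OF p])
  also have "?p * ?y\<^sup>2 = \<alpha> t * (\<kappa>\<^sup>2 / (1 - \<kappa>)) * (N (U t \<omega>))\<^sup>2"
  proof -
    have "(1 - \<kappa>) * (\<kappa> / (1 - \<kappa>))\<^sup>2 = \<kappa>\<^sup>2 / (1 - \<kappa>)" using \<kappa> by (simp add: power2_eq_square)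
    moreover have "?p * ?y\<^sup>2 = \<alpha> t * ((1 - \<kappa>) * (\<kappa> / (1 - \<kappa>))\<^sup>2) * (N (U t \<omega>))\<^sup>2"
      unfolding power_mult_distrib by (simp only: ac_simps)
    ultimately show ?thesis by simp
  qed
  also have "\<dots> \<le> \<alpha> t * (\<kappa>\<^sup>2 / (1 - \<kappa>)) * (n\<^sub>1 * norm (U t \<omega>))\<^sup>2"
    using n\<^sub>1 is_norm_nonneg[OF N] a \<kappa> by (intro mult_left_mono power_mono) auto
  also have "\<dots> = \<alpha> t * k\<^sub>X * (norm (U t \<omega>))\<^sup>2"
    by (simp add: k\<^sub>X_def power_mult_distrib)
  finally show ?thesis by simp
qed

text \<open>The weight of the second moment of \<open>U\<close> is chosen so that half of it,
  already, dominates the term \<open>k\<^sub>X\<close> that \<open>X_step\<close> produces.\<close>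

definition z :: "nat \<Rightarrow> real" where
  "z t = expectation (\<lambda>\<omega>. (N (X t \<omega>))\<^sup>2) + (2 * k\<^sub>X + 1) * expectation (\<lambda>\<omega>. (norm (U t \<omega>))\<^sup>2)"

lemma z_ge:
  "expectation (\<lambda>\<omega>. (N (X t \<omega>))\<^sup>2) \<le> z t" "expectation (\<lambda>\<omega>. (norm (U t \<omega>))\<^sup>2) \<le> z t"
proof -
  let ?a = "expectation (\<lambda>\<omega>. (norm (U t \<omega>))\<^sup>2)" and ?b = "expectation (\<lambda>\<omega>. (N (X t \<omega>))\<^sup>2)"
  have 0: "0 \<le> ?a" "0 \<le> ?b" by (auto intro!: integral_nonneg_AE)
  have "?a \<le> (2 * k\<^sub>X + 1) * ?a" using 0 k\<^sub>X_nonneg mult_right_mono[of 1 "2 * k\<^sub>X + 1" ?a] by simp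
  with 0 show "?b \<le> z t" "?a \<le> z t" unfolding z_def by linarith+
qed

lemma error_le_z: "expectation (\<lambda>\<omega>. (norm (w t \<omega> - ws))\<^sup>2) \<le> (2 * n\<^sub>2\<^sup>2 + 2) * z t"
proof -
  have "expectation (\<lambda>\<omega>. (norm (w t \<omega> - ws))\<^sup>2)
      \<le> expectation (\<lambda>\<omega>. 2 * n\<^sub>2\<^sup>2 * (N (X t \<omega>))\<^sup>2 + 2 * (norm (U t \<omega>))\<^sup>2)"
  proof (intro expectation_mono rv_intros)
    fix \<omega>
    have "norm (w t \<omega> - ws) \<le> norm (X t \<omega>) + norm (U t \<omega>)"
      using norm_triangle_ineq[of "X t \<omega>" "U t \<omega>"] by (simp add: X_def)
    also have "\<dots> \<le> n\<^sub>2 * N (X t \<omega>) + norm (U t \<omega>)" using n\<^sub>2(1) by simp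
    finally have "(norm (w t \<omega> - ws))\<^sup>2 \<le> (n\<^sub>2 * N (X t \<omega>) + norm (U t \<omega>))\<^sup>2" by (intro power_mono) auto
    also have "\<dots> \<le> 2 * (n\<^sub>2 * N (X t \<omega>))\<^sup>2 + 2 * (norm (U t \<omega>))\<^sup>2"
      using sum_squares_bound[of "n\<^sub>2 * N (X t \<omega>)" "norm (U t \<omega>)"] by (simp add: power2_sum)
    finally show "(norm (w t \<omega> - ws))\<^sup>2 \<le> 2 * n\<^sub>2\<^sup>2 * (N (X t \<omega>))\<^sup>2 + 2 * (norm (U t \<omega>))\<^sup>2"
      by (simp add: power_mult_distrib)
  qed
  also have "\<dots> = 2 * n\<^sub>2\<^sup>2 * expectation (\<lambda>\<omega>. (N (X t \<omega>))\<^sup>2) + 2 * expectation (\<lambda>\<omega>. (norm (U t \<omega>))\<^sup>2)"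
    by (subst Bochner_Integration.integral_add) (auto intro!: bounded_rv_integrable rv_intros)
  also have "\<dots> \<le> 2 * n\<^sub>2\<^sup>2 * z t + 2 * z t"
    by (intro add_mono mult_left_mono z_ge) auto
  finally show ?thesis by (simp add: algebra_simps)
qed

text \<open>The factor 3 comes from squaring the three summands of \<open>V\<close>, and the 6 from
  also splitting \<open>w\<close> into \<open>ws\<close> and the error, whose second moment is
  bounded by \<open>error_le_z\<close>.\<close>

definition k\<^sub>V :: real where "k\<^sub>V = 3 * (1 + 2 * (norm ws)\<^sup>2) + 6 * (2 * n\<^sub>2\<^sup>2 + 2) + 3"

lemma k\<^sub>V_nonneg: "0 \<le> k\<^sub>V"
  by (simp add: k\<^sub>V_def)

text \<open>The constant part of \<open>V\<close> is absorbed by \<open>1 \<le> B\<close>, which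
  makes the bound linear in \<open>B\<close>, as \<open>recursion_bounded\<close> demands.\<close>

lemma V_second_moment:
  assumes "z t \<le> B" "1 \<le> B"
  shows "expectation (\<lambda>\<omega>. (V t \<omega>)\<^sup>2) \<le> k\<^sub>V * B"
proof -
  have "expectation (\<lambda>\<omega>. (V t \<omega>)\<^sup>2)
      \<le> expectation (\<lambda>\<omega>. 3 * (1 + 2 * (norm ws)\<^sup>2) + 6 * (norm (w t \<omega> - ws))\<^sup>2 + 3 * (norm (U t \<omega>))\<^sup>2)"
  proof (intro expectation_mono rv_intros)
    fix \<omega>
    let ?x = "norm (w t \<omega>)" and ?u = "norm (U t \<omega>)" and ?e = "norm (w t \<omega> - ws)"
    have "?x \<le> norm ws + ?e" using norm_triangle_ineq[of ws "w t \<omega> - ws"] by simp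
    then have "?x\<^sup>2 \<le> (norm ws + ?e)\<^sup>2" by (intro power_mono) auto
    also have "\<dots> \<le> 2 * (norm ws)\<^sup>2 + 2 * ?e\<^sup>2"
      using sum_squares_bound[of "norm ws" ?e] by (simp add: power2_sum)
    finally have x: "?x\<^sup>2 \<le> 2 * (norm ws)\<^sup>2 + 2 * ?e\<^sup>2" .
    have "(V t \<omega>)\<^sup>2 \<le> 3 * (1 + ?x\<^sup>2 + ?u\<^sup>2)"
      using sum_squares_bound[of 1 ?x] sum_squares_bound[of 1 ?u] sum_squares_bound[of ?x ?u]
      unfolding V_def by (simp add: power2_eq_square algebra_simps)
    with x show "(V t \<omega>)\<^sup>2 \<le> 3 * (1 + 2 * (norm ws)\<^sup>2) + 6 * ?e\<^sup>2 + 3 * ?u\<^sup>2" by simp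
  qed
  also have "\<dots> = 3 * (1 + 2 * (norm ws)\<^sup>2) + 6 * expectation (\<lambda>\<omega>. (norm (w t \<omega> - ws))\<^sup>2)
      + 3 * expectation (\<lambda>\<omega>. (norm (U t \<omega>))\<^sup>2)"
    by (subst Bochner_Integration.integral_add, (intro bounded_rv_integrable rv_intros)+)+
       (simp add: prob_space)
  also have "\<dots> \<le> 3 * (1 + 2 * (norm ws)\<^sup>2) * B + 6 * ((2 * n\<^sub>2\<^sup>2 + 2) * B) + 3 * B"
  proof (intro add_mono mult_left_mono)
    show "3 * (1 + 2 * (norm ws)\<^sup>2) \<le> 3 * (1 + 2 * (norm ws)\<^sup>2) * B"
      using assms(2) mult_left_mono[OF assms(2), of "3 * (1 + 2 * (norm ws)\<^sup>2)"] by simp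
    show "expectation (\<lambda>\<omega>. (norm (w t \<omega> - ws))\<^sup>2) \<le> (2 * n\<^sub>2\<^sup>2 + 2) * B"
      using error_le_z[of t] mult_left_mono[OF assms(1), of "2 * n\<^sub>2\<^sup>2 + 2"] by simp
    show "expectation (\<lambda>\<omega>. (norm (U t \<omega>))\<^sup>2) \<le> B" using z_ge(2)[of t] assms(1) by linarith
  qed auto
  also have "\<dots> = k\<^sub>V * B" by (simp add: k\<^sub>V_def algebra_simps)
  finally show ?thesis .
qed

text \<open>Freezing creates products of \<open>V\<close> at two times; the arithmetic-geometric
  inequality reduces them to second moments.\<close>

lemma V_product:
  assumes "z i \<le> B" "z j \<le> B" "1 \<le> B"
  shows "expectation (\<lambda>\<omega>. V i \<omega> * V j \<omega>) \<le> k\<^sub>V * B"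
proof -
  have "expectation (\<lambda>\<omega>. V i \<omega> * V j \<omega>) \<le> expectation (\<lambda>\<omega>. (V i \<omega>)\<^sup>2 / 2 + (V j \<omega>)\<^sup>2 / 2)"
  proof (rule expectation_mono)
    show "bounded_rv M (\<lambda>\<omega>. (V i \<omega>)\<^sup>2 / 2 + (V j \<omega>)\<^sup>2 / 2)"
      unfolding divide_inverse by (intro rv_intros)
    fix \<omega> show "V i \<omega> * V j \<omega> \<le> (V i \<omega>)\<^sup>2 / 2 + (V j \<omega>)\<^sup>2 / 2"
      using sum_squares_bound[of "V i \<omega>" "V j \<omega>"] by simp
  qed (intro rv_intros)
  also have "\<dots> = expectation (\<lambda>\<omega>. (V i \<omega>)\<^sup>2) / 2 + expectation (\<lambda>\<omega>. (V j \<omega>)\<^sup>2) / 2"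
    by (subst Bochner_Integration.integral_add) (auto intro!: bounded_rv_integrable rv_intros integrable_divide)
  also have "\<dots> \<le> k\<^sub>V * B"
    using V_second_moment[OF assms(1,3)] V_second_moment[OF assms(2,3)] by simp
  finally show ?thesis .
qed

section \<open>Correlation of the averaged noise with the current noise\<close>

definition G :: real where "G = 2 * L + 2"

lemma G_ge: "2 * L \<le> G" "2 * L + 1 \<le> G" "0 \<le> G"
  using L by (auto simp: G_def)

lemma noise_le: "\<omega> \<in> space M \<Longrightarrow> norm (noise t \<omega>) \<le> G * V t \<omega>"
  using noise_bound[of \<omega> t] mult_right_mono[OF G_ge(2), of "V t \<omega>"] V_ge(1)[of t \<omega>] by linarith

text \<open>Freezing the iterates at the earlier time \<open>s\<close> costs the total step size between \<open>s\<close> and \<open>t\<close>;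
  after freezing, the correlation decays at the mixing rate.\<close>

lemma cross_term:
  assumes s: "s \<le> t" and B: "1 \<le> B" "\<And>i. i \<le> t \<Longrightarrow> z i \<le> B"
  shows "expectation (\<lambda>\<omega>. U t \<omega> \<bullet> noise t \<omega>)
    \<le> (4 * L * c\<^sub>A + 2 * G\<^sup>2) * k\<^sub>V * B * (\<rho> ^ (Suc t - s) + (\<Sum>i=s..<t. \<alpha> i))"
proof -
  define \<eta> where "\<eta> \<omega> = H (w s \<omega>) (Y (Suc t) \<omega>) - h (w s \<omega>)" for \<omega>
  have rv\<eta>: "bounded_rv M \<eta>" unfolding \<eta>_def[abs_def] by (intro rv_intros)
  define A where "A = (\<Sum>i=s..<t. \<alpha> i)"
  have A0: "0 \<le> A" unfolding A_def using \<alpha>_pos by (intro sum_nonneg) (auto intro: less_imp_le)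
  have "expectation (\<lambda>\<omega>. U t \<omega> \<bullet> noise t \<omega>)
      \<le> expectation (\<lambda>\<omega>. U s \<omega> \<bullet> \<eta> \<omega> + (\<Sum>i=s..<t. \<alpha> i * G\<^sup>2 * (V i \<omega> * V s \<omega> + V i \<omega> * V t \<omega>)))"
  proof (intro expectation_mono rv_intros rv\<eta>)
    fix \<omega> assume \<omega>: "\<omega> \<in> space M"
    let ?D = "\<Sum>i=s..<t. \<alpha> i * (G * V i \<omega>)"
    have dw: "norm (w t \<omega> - w s \<omega>) \<le> ?D"
    proof (rule norm_telescope[OF _ s])
      fix i
      have "\<alpha> i * ((2 * L + 1) * V i \<omega>) \<le> \<alpha> i * (G * V i \<omega>)"
        using \<alpha>_pos[of i] G_ge V_ge(1)[of i \<omega>] by (intro mult_left_mono mult_right_mono) auto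
      then show "norm (w (Suc i) \<omega> - w i \<omega>) \<le> \<alpha> i * (G * V i \<omega>)"
        using w_increment[OF \<omega>, of i] by linarith
    qed
    have dU: "norm (U t \<omega> - U s \<omega>) \<le> ?D"
      using U_increment[OF \<omega>] by (intro norm_telescope[OF _ s]) (simp only: G_def)
    have "norm (noise t \<omega> - \<eta> \<omega>)
        \<le> norm (H (w t \<omega>) (Y (Suc t) \<omega>) - H (w s \<omega>) (Y (Suc t) \<omega>)) + norm (h (w t \<omega>) - h (w s \<omega>))"
      unfolding noise_def \<eta>_def by (rule order_trans[OF _ norm_triangle_ineq4]) (simp add: algebra_simps)
    also have "\<dots> \<le> 2 * L * norm (w t \<omega> - w s \<omega>)"
      using H_lip[OF Y_space[OF \<omega>], of "w t \<omega>" "Suc t" "w s \<omega>"] h_lip[of "w t \<omega>" "w s \<omega>"] by simp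
    also have "\<dots> \<le> G * ?D" using dw G_ge by (intro mult_mono) auto
    finally have dn: "norm (noise t \<omega> - \<eta> \<omega>) \<le> G * ?D" .
    have D0: "0 \<le> ?D" using dU norm_ge_zero[of "U t \<omega> - U s \<omega>"] by linarith
    have "U t \<omega> \<bullet> noise t \<omega> = U s \<omega> \<bullet> \<eta> \<omega> + U s \<omega> \<bullet> (noise t \<omega> - \<eta> \<omega>) + (U t \<omega> - U s \<omega>) \<bullet> noise t \<omega>"
      by (simp add: inner_diff_left inner_diff_right)
    also have "U s \<omega> \<bullet> (noise t \<omega> - \<eta> \<omega>) \<le> V s \<omega> * (G * ?D)"
      by (rule order_trans[OF norm_cauchy_schwarz]) (intro mult_mono dn V_ge norm_ge_zero order_trans[OF norm_ge_zero V_ge(2)])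
    also have "(U t \<omega> - U s \<omega>) \<bullet> noise t \<omega> \<le> ?D * (G * V t \<omega>)"
      by (rule order_trans[OF norm_cauchy_schwarz]) (intro mult_mono dU noise_le \<omega> norm_ge_zero D0)
    also have "U s \<omega> \<bullet> \<eta> \<omega> + V s \<omega> * (G * ?D) + ?D * (G * V t \<omega>)
        = U s \<omega> \<bullet> \<eta> \<omega> + (\<Sum>i=s..<t. \<alpha> i * G\<^sup>2 * (V i \<omega> * V s \<omega> + V i \<omega> * V t \<omega>))"
      by (simp add: sum_distrib_left sum_distrib_right sum.distrib[symmetric] power2_eq_square algebra_simps)
    finally show "U t \<omega> \<bullet> noise t \<omega> \<le> U s \<omega> \<bullet> \<eta> \<omega> + (\<Sum>i=s..<t. \<alpha> i * G\<^sup>2 * (V i \<omega> * V s \<omega> + V i \<omega> * V t \<omega>))"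
      by simp
  qed
  also have "\<dots> = expectation (\<lambda>\<omega>. U s \<omega> \<bullet> \<eta> \<omega>)
      + (\<Sum>i=s..<t. \<alpha> i * G\<^sup>2 * (expectation (\<lambda>\<omega>. V i \<omega> * V s \<omega>) + expectation (\<lambda>\<omega>. V i \<omega> * V t \<omega>)))"
  proof -
    have "expectation (\<lambda>\<omega>. \<Sum>i=s..<t. \<alpha> i * G\<^sup>2 * (V i \<omega> * V s \<omega> + V i \<omega> * V t \<omega>))
      = (\<Sum>i=s..<t. expectation (\<lambda>\<omega>. \<alpha> i * G\<^sup>2 * (V i \<omega> * V s \<omega> + V i \<omega> * V t \<omega>)))"
      by (rule Bochner_Integration.integral_sum) (intro bounded_rv_integrable rv_intros)
    also have "\<dots> = (\<Sum>i=s..<t. \<alpha> i * G\<^sup>2 * (expectation (\<lambda>\<omega>. V i \<omega> * V s \<omega>) + expectation (\<lambda>\<omega>. V i \<omega> * V t \<omega>)))"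
      by (simp add: Bochner_Integration.integral_add[OF bounded_rv_integrable bounded_rv_integrable]
          bounded_rv_mult[OF bounded_rv_V bounded_rv_V])
    finally show ?thesis
      by (subst Bochner_Integration.integral_add) (intro bounded_rv_integrable rv_intros rv\<eta> | simp)+
  qed
  also have "\<dots> \<le> 4 * L * (c\<^sub>A * \<rho> ^ (Suc t - s)) * (k\<^sub>V * B) + (\<Sum>i=s..<t. \<alpha> i * G\<^sup>2 * (k\<^sub>V * B + k\<^sub>V * B))"
  proof (rule add_mono)
    obtain b1 where b1: "\<And>\<omega>. \<omega> \<in> space M \<Longrightarrow> norm (U s \<omega>) \<le> b1" using bounded_rvE[OF bounded_rv_U] by metis
    obtain b2 where b2: "\<And>\<omega>. \<omega> \<in> space M \<Longrightarrow> norm (w s \<omega>) \<le> b2" using bounded_rvE[OF bounded_rv_w] by metis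
    have "\<bar>expectation (\<lambda>\<omega>. U s \<omega> \<bullet> (H (w s \<omega>) (Y (s + (Suc t - s)) \<omega>) - h (w s \<omega>)))\<bar>
      \<le> 4 * L * (c\<^sub>A * \<rho> ^ (Suc t - s)) * expectation (\<lambda>\<omega>. norm (U s \<omega>) * (1 + norm (w s \<omega>)))"
    proof (rule markov_mixing_inner[OF MC d mix H_meas H_bound L H_cont h_def h_cont])
      show "norm (U s \<omega>) \<le> max b1 b2" "norm (w s \<omega>) \<le> max b1 b2" if "\<omega> \<in> space M" for \<omega>
        using b1[OF that] b2[OF that] by auto
    qed (use past_measurable[of s] in auto)
    moreover have "s + (Suc t - s) = Suc t" using s by simp
    ultimately have "\<bar>expectation (\<lambda>\<omega>. U s \<omega> \<bullet> \<eta> \<omega>)\<bar>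
      \<le> 4 * L * (c\<^sub>A * \<rho> ^ (Suc t - s)) * expectation (\<lambda>\<omega>. norm (U s \<omega>) * (1 + norm (w s \<omega>)))"
      unfolding \<eta>_def by simp
    also have "\<dots> \<le> 4 * L * (c\<^sub>A * \<rho> ^ (Suc t - s)) * (k\<^sub>V * B)"
    proof (rule mult_left_mono)
      have "expectation (\<lambda>\<omega>. norm (U s \<omega>) * (1 + norm (w s \<omega>))) \<le> expectation (\<lambda>\<omega>. V s \<omega> * V s \<omega>)"
        by (intro expectation_mono rv_intros mult_mono V_ge order_trans[OF norm_ge_zero V_ge(2)]) auto
      also have "\<dots> \<le> k\<^sub>V * B" using s B by (intro V_product) auto
      finally show "expectation (\<lambda>\<omega>. norm (U s \<omega>) * (1 + norm (w s \<omega>))) \<le> k\<^sub>V * B" .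
    qed (use L c\<^sub>A \<rho> in auto)
    finally show "expectation (\<lambda>\<omega>. U s \<omega> \<bullet> \<eta> \<omega>) \<le> 4 * L * (c\<^sub>A * \<rho> ^ (Suc t - s)) * (k\<^sub>V * B)" by simp
    show "(\<Sum>i=s..<t. \<alpha> i * G\<^sup>2 * (expectation (\<lambda>\<omega>. V i \<omega> * V s \<omega>) + expectation (\<lambda>\<omega>. V i \<omega> * V t \<omega>)))
      \<le> (\<Sum>i=s..<t. \<alpha> i * G\<^sup>2 * (k\<^sub>V * B + k\<^sub>V * B))"
      using s B \<alpha>_pos
      by (intro sum_mono mult_left_mono add_mono V_product) (auto intro!: mult_nonneg_nonneg intro: less_imp_le)
  qed
  also have "\<dots> = 4 * L * c\<^sub>A * k\<^sub>V * B * \<rho> ^ (Suc t - s) + 2 * G\<^sup>2 * k\<^sub>V * B * A"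
    unfolding A_def by (simp add: sum_distrib_left sum_distrib_right algebra_simps)
  also have "\<dots> \<le> (4 * L * c\<^sub>A + 2 * G\<^sup>2) * k\<^sub>V * B * (\<rho> ^ (Suc t - s) + A)"
  proof -
    have "0 \<le> 2 * G\<^sup>2 * k\<^sub>V * B * \<rho> ^ (Suc t - s)" "0 \<le> 4 * L * c\<^sub>A * k\<^sub>V * B * A"
      using B L c\<^sub>A \<rho> k\<^sub>V_nonneg A0 by auto
    then show ?thesis by (simp add: algebra_simps)
  qed
  finally show ?thesis by (simp add: A_def)
qed

text \<open>Expanding the square gives a contraction, a cross term of weight at most
  \<open>2 * \<alpha> t\<close> and the squared noise of weight \<open>(\<alpha> t)\<^sup>2\<close>.
  Only the cross term needs mixing.\<close>

lemma U_step:
  assumes s: "s \<le> t" and B: "1 \<le> B" "\<And>i. i \<le> t \<Longrightarrow> z i \<le> B" and a: "\<alpha> t \<le> 1"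
  shows "expectation (\<lambda>\<omega>. (norm (U (Suc t) \<omega>))\<^sup>2)
    \<le> (1 - \<alpha> t) * expectation (\<lambda>\<omega>. (norm (U t \<omega>))\<^sup>2)
      + \<alpha> t * (2 * (4 * L * c\<^sub>A + 2 * G\<^sup>2) * k\<^sub>V * (\<rho> ^ (Suc t - s) + (\<Sum>i=s..<t. \<alpha> i)) + G\<^sup>2 * k\<^sub>V * \<alpha> t) * B"
proof -
  define E where "E = (4 * L * c\<^sub>A + 2 * G\<^sup>2) * k\<^sub>V * B * (\<rho> ^ (Suc t - s) + (\<Sum>i=s..<t. \<alpha> i))"
  have a0: "0 \<le> \<alpha> t" using \<alpha>_pos[of t] by simp
  \<comment> \<open>The correlation itself may be negative; the factor \<open>1 - \<alpha> t\<close>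
    is dropped only after replacing it by the nonnegative bound \<open>E\<close>.\<close>
  have E0: "0 \<le> E" unfolding E_def using L c\<^sub>A B(1) k\<^sub>V_nonneg \<rho> \<alpha>_pos
    by (intro mult_nonneg_nonneg add_nonneg_nonneg sum_nonneg) (auto intro: less_imp_le)
  have "expectation (\<lambda>\<omega>. (norm (U (Suc t) \<omega>))\<^sup>2)
    \<le> expectation (\<lambda>\<omega>. (1 - \<alpha> t) * (norm (U t \<omega>))\<^sup>2 + 2 * \<alpha> t * (1 - \<alpha> t) * (U t \<omega> \<bullet> noise t \<omega>)
        + (\<alpha> t)\<^sup>2 * G\<^sup>2 * (V t \<omega>)\<^sup>2)"
  proof (intro expectation_mono rv_intros)
    fix \<omega> assume \<omega>: "\<omega> \<in> space M"
    have "(norm (U (Suc t) \<omega>))\<^sup>2 = (1 - \<alpha> t)\<^sup>2 * (norm (U t \<omega>))\<^sup>2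
        + 2 * \<alpha> t * (1 - \<alpha> t) * (U t \<omega> \<bullet> noise t \<omega>) + (\<alpha> t)\<^sup>2 * (norm (noise t \<omega>))\<^sup>2"
      unfolding U.simps power2_norm_eq_inner
      by (simp add: inner_add_left inner_add_right inner_commute power2_eq_square algebra_simps)
    also have "(1 - \<alpha> t)\<^sup>2 * (norm (U t \<omega>))\<^sup>2 \<le> (1 - \<alpha> t) * (norm (U t \<omega>))\<^sup>2"
      using a a0 by (intro mult_right_mono) (auto simp: power2_eq_square mult_left_le)
    also have "(\<alpha> t)\<^sup>2 * (norm (noise t \<omega>))\<^sup>2 \<le> (\<alpha> t)\<^sup>2 * (G * V t \<omega>)\<^sup>2"
      using noise_le[OF \<omega>] by (intro mult_left_mono power_mono) auto
    finally show "(norm (U (Suc t) \<omega>))\<^sup>2 \<le> (1 - \<alpha> t) * (norm (U t \<omega>))\<^sup>2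
        + 2 * \<alpha> t * (1 - \<alpha> t) * (U t \<omega> \<bullet> noise t \<omega>) + (\<alpha> t)\<^sup>2 * G\<^sup>2 * (V t \<omega>)\<^sup>2"
      by (simp add: power_mult_distrib)
  qed
  also have "\<dots> = (1 - \<alpha> t) * expectation (\<lambda>\<omega>. (norm (U t \<omega>))\<^sup>2)
      + 2 * \<alpha> t * (1 - \<alpha> t) * expectation (\<lambda>\<omega>. U t \<omega> \<bullet> noise t \<omega>)
      + (\<alpha> t)\<^sup>2 * G\<^sup>2 * expectation (\<lambda>\<omega>. (V t \<omega>)\<^sup>2)"
    by (subst Bochner_Integration.integral_add, (intro bounded_rv_integrable rv_intros)+)+ simp
  also have "\<dots> \<le> (1 - \<alpha> t) * expectation (\<lambda>\<omega>. (norm (U t \<omega>))\<^sup>2) + 2 * \<alpha> t * E + (\<alpha> t)\<^sup>2 * G\<^sup>2 * (k\<^sub>V * B)"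
  proof (intro add_mono order_refl)
    have "2 * \<alpha> t * (1 - \<alpha> t) * expectation (\<lambda>\<omega>. U t \<omega> \<bullet> noise t \<omega>) \<le> 2 * \<alpha> t * (1 - \<alpha> t) * E"
      unfolding E_def using a a0 by (intro mult_left_mono cross_term s B) auto
    also have "\<dots> \<le> 2 * \<alpha> t * E" using a a0 E0 by (intro mult_right_mono) (auto simp: mult_left_le)
    finally show "2 * \<alpha> t * (1 - \<alpha> t) * expectation (\<lambda>\<omega>. U t \<omega> \<bullet> noise t \<omega>) \<le> 2 * \<alpha> t * E" .
    show "(\<alpha> t)\<^sup>2 * G\<^sup>2 * expectation (\<lambda>\<omega>. (V t \<omega>)\<^sup>2) \<le> (\<alpha> t)\<^sup>2 * G\<^sup>2 * (k\<^sub>V * B)"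
      using B by (intro mult_left_mono V_second_moment) auto
  qed
  also have "\<dots> = (1 - \<alpha> t) * expectation (\<lambda>\<omega>. (norm (U t \<omega>))\<^sup>2)
      + \<alpha> t * (2 * (4 * L * c\<^sub>A + 2 * G\<^sup>2) * k\<^sub>V * (\<rho> ^ (Suc t - s) + (\<Sum>i=s..<t. \<alpha> i)) + G\<^sup>2 * k\<^sub>V * \<alpha> t) * B"
    unfolding E_def by (simp add: power2_eq_square algebra_simps)
  finally show ?thesis .
qed

section \<open>Recursion for the Lyapunov function and the mean-square rate\<close>

text \<open>A common contraction rate for both parts of \<open>z\<close>. The cap 1/2 reserves half
  of the unit rate of \<open>U\<close> for absorbing the coupling term in
  \<open>X_step\<close>.\<close>

definition c :: real where "c = min (1 - \<kappa>) (1 / 2)"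

lemma c: "0 < c" "c \<le> 1 - \<kappa>" "c \<le> 1 / 2"
  unfolding c_def using \<kappa> by linarith+

lemma z_step:
  obtains T D where "0 \<le> D" "\<And>t. T \<le> t \<Longrightarrow> \<alpha> t \<le> 1"
    "\<And>t B. T \<le> t \<Longrightarrow> 1 \<le> B \<Longrightarrow> (\<And>i. i \<le> t \<Longrightarrow> z i \<le> B) \<Longrightarrow>
      z (Suc t) \<le> (1 - c * \<alpha> t) * z t + \<alpha> t * (D * (real t + 3) powr (- (\<nu> - 1/4))) * B"
proof -
  \<comment> \<open>The lag exponent 1/4 fixes the order \<open>\<nu> - 1/4\<close> of the
    perturbation; the contribution of the squared noise is of the smaller order \<nu>.\<close>
  obtain T C' where lag: "0 \<le> C'"
    "\<And>t. T \<le> t \<Longrightarrow> \<exists>s\<le>t. \<rho> ^ (Suc t - s) + (\<Sum>i=s..<t. \<alpha> i) \<le> C' * (real t + 3) powr (- (\<nu> - 1/4))"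
  proof (rule exists_lag[OF \<alpha> C _ \<rho>, of "1/4"])
    show "0 < \<nu>" using \<nu> by simp
  qed auto
  have "\<alpha> \<longlonglongrightarrow> 0" unfolding \<alpha>[abs_def] using \<nu> by real_asymp
  then have "eventually (\<lambda>t. \<alpha> t < 1) sequentially" by (rule order_tendstoD) simp
  then obtain T' where T': "\<And>t. T' \<le> t \<Longrightarrow> \<alpha> t \<le> 1" by (auto simp: eventually_sequentially intro: less_imp_le)
  define k where "k = 2 * (4 * L * c\<^sub>A + 2 * G\<^sup>2) * k\<^sub>V * C' + G\<^sup>2 * k\<^sub>V * C"
  have k0: "0 \<le> k" unfolding k_def using L c\<^sub>A k\<^sub>V_nonneg lag(1) C
    by (intro add_nonneg_nonneg mult_nonneg_nonneg) auto
  let ?l = "2 * k\<^sub>X + 1"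
  show ?thesis
  proof (rule that[of "?l * k" "max T T'"])
    show "0 \<le> ?l * k" using k\<^sub>X_nonneg k0 by simp
    show "\<alpha> t \<le> 1" if "max T T' \<le> t" for t using that T' by auto
    fix t B assume t: "max T T' \<le> t" and B: "1 \<le> B" "\<And>i. i \<le> t \<Longrightarrow> z i \<le> B"
    let ?r = "(real t + 3) powr (- (\<nu> - 1/4))"
    let ?a = "expectation (\<lambda>\<omega>. (norm (U t \<omega>))\<^sup>2)" and ?b = "expectation (\<lambda>\<omega>. (N (X t \<omega>))\<^sup>2)"
    have a: "\<alpha> t \<le> 1" "0 \<le> \<alpha> t" using T' t \<alpha>_pos[of t] by auto
    have ab0: "0 \<le> ?a" "0 \<le> ?b" by (auto intro!: integral_nonneg_AE)
    obtain s where s: "s \<le> t" "\<rho> ^ (Suc t - s) + (\<Sum>i=s..<t. \<alpha> i) \<le> C' * ?r" using lag(2) t by auto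
    have \<alpha>r: "\<alpha> t \<le> C * ?r"
    proof -
      have "(real t + 3) powr (- \<nu>) \<le> ?r" by (intro powr_mono) auto
      then have "C * (real t + 3) powr (- \<nu>) \<le> C * ?r" using C by (intro mult_left_mono) auto
      moreover have "\<alpha> t = C * (real t + 3) powr (- \<nu>)" unfolding \<alpha> powr_minus by (simp only: divide_inverse)
      ultimately show ?thesis by (simp only:)
    qed
    have "2 * (4 * L * c\<^sub>A + 2 * G\<^sup>2) * k\<^sub>V * (\<rho> ^ (Suc t - s) + (\<Sum>i=s..<t. \<alpha> i)) + G\<^sup>2 * k\<^sub>V * \<alpha> t
      \<le> 2 * (4 * L * c\<^sub>A + 2 * G\<^sup>2) * k\<^sub>V * (C' * ?r) + G\<^sup>2 * k\<^sub>V * (C * ?r)"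
      using s(2) \<alpha>r L c\<^sub>A k\<^sub>V_nonneg by (intro add_mono mult_left_mono mult_nonneg_nonneg) auto
    also have "\<dots> = k * ?r" by (simp add: k_def algebra_simps)
    finally have "\<alpha> t * (2 * (4 * L * c\<^sub>A + 2 * G\<^sup>2) * k\<^sub>V * (\<rho> ^ (Suc t - s) + (\<Sum>i=s..<t. \<alpha> i)) + G\<^sup>2 * k\<^sub>V * \<alpha> t) * B
      \<le> \<alpha> t * (k * ?r) * B"
      using a B(1) by (intro mult_right_mono mult_left_mono) auto
    with U_step[OF s(1) B a(1)]
    have Ub: "expectation (\<lambda>\<omega>. (norm (U (Suc t) \<omega>))\<^sup>2) \<le> (1 - \<alpha> t) * ?a + \<alpha> t * (k * ?r) * B" by linarith
    have "expectation (\<lambda>\<omega>. (N (X (Suc t) \<omega>))\<^sup>2)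
      \<le> expectation (\<lambda>\<omega>. (1 - (1 - \<kappa>) * \<alpha> t) * (N (X t \<omega>))\<^sup>2 + \<alpha> t * k\<^sub>X * (norm (U t \<omega>))\<^sup>2)"
      by (intro expectation_mono rv_intros X_step a(1))
    also have "\<dots> = (1 - (1 - \<kappa>) * \<alpha> t) * ?b + \<alpha> t * k\<^sub>X * ?a"
      by (subst Bochner_Integration.integral_add) (auto intro!: bounded_rv_integrable rv_intros)
    also have "\<dots> \<le> (1 - c * \<alpha> t) * ?b + \<alpha> t * k\<^sub>X * ?a"
      using c(2) a ab0 by (intro add_right_mono mult_right_mono) (auto intro: mult_right_mono)
    finally have Xb: "expectation (\<lambda>\<omega>. (N (X (Suc t) \<omega>))\<^sup>2) \<le> (1 - c * \<alpha> t) * ?b + \<alpha> t * k\<^sub>X * ?a" .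
    have "z (Suc t) \<le> (1 - c * \<alpha> t) * ?b + \<alpha> t * k\<^sub>X * ?a + ?l * ((1 - \<alpha> t) * ?a + \<alpha> t * (k * ?r) * B)"
      unfolding z_def using Xb Ub k\<^sub>X_nonneg by (intro add_mono mult_left_mono) auto
    \<comment> \<open>Charging \<open>U\<close> only the rate \<open>c\<close> instead of 1 leaves a
      surplus, which pays for the coupling term \<open>\<alpha> t * k\<^sub>X * ?a\<close>.\<close>
    also have "\<dots> = (1 - c * \<alpha> t) * z t + \<alpha> t * (?l * k * ?r) * B - \<alpha> t * ?a * ((1 - c) * ?l - k\<^sub>X)"
      by (simp add: z_def algebra_simps)
    also have "\<dots> \<le> (1 - c * \<alpha> t) * z t + \<alpha> t * (?l * k * ?r) * B"
    proof -
      have "1 / 2 * ?l \<le> (1 - c) * ?l" using c k\<^sub>X_nonneg by (intro mult_right_mono) auto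
      then have "0 \<le> (1 - c) * ?l - k\<^sub>X" by simp
      then show ?thesis using a ab0 by simp
    qed
    finally show "z (Suc t) \<le> (1 - c * \<alpha> t) * z t + \<alpha> t * (?l * k * ?r) * B" .
  qed
qed

text \<open>Two passes through the same recursion: the first gives a uniform bound \<open>B\<close>,
  the second uses that \<open>B\<close> as a constant, so the perturbation becomes a forcing of
  order \<open>t powr (- r)\<close>. For \<open>\<nu> < 1\<close> the product of step size and time
  diverges and any admissible \<open>r\<close> is reached; for \<open>\<nu> = 1\<close> it equals
  \<open>C\<close>, which caps \<open>r\<close>.\<close>

lemma mean_square_rate:
  assumes r: "0 \<le> r" "r \<le> \<nu> - 1/4" "\<nu> < 1 \<or> r \<le> c / 2 * C"
  obtains D where "0 \<le> D" "\<And>t. expectation (\<lambda>\<omega>. (norm (w t \<omega> - ws))\<^sup>2) \<le> D * (real t + 3) powr (- r)"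
proof -
  obtain T D where D: "0 \<le> D" "\<And>t. T \<le> t \<Longrightarrow> \<alpha> t \<le> 1"
    "\<And>t B. T \<le> t \<Longrightarrow> 1 \<le> B \<Longrightarrow> (\<And>i. i \<le> t \<Longrightarrow> z i \<le> B) \<Longrightarrow>
      z (Suc t) \<le> (1 - c * \<alpha> t) * z t + \<alpha> t * (D * (real t + 3) powr (- (\<nu> - 1/4))) * B"
    by (rule z_step, rule that, assumption) (drule meta_spec, erule meta_mp, assumption, blast)
  have c\<alpha>: "c * \<alpha> t \<le> 1" if "T \<le> t" for t
    using c \<kappa> D(2)[OF that] \<alpha>_pos[of t] by (intro mult_le_one) auto
  have "(\<lambda>t. D * (real t + 3) powr (- (\<nu> - 1/4))) \<longlonglongrightarrow> D * 0"
    using \<nu> by (intro tendsto_mult_left) real_asymp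
  then have "eventually (\<lambda>t. D * (real t + 3) powr (- (\<nu> - 1/4)) < c) sequentially"
    using c(1) by (intro order_tendstoD) auto
  then obtain T1 where T1: "\<And>t. T1 \<le> t \<Longrightarrow> D * (real t + 3) powr (- (\<nu> - 1/4)) \<le> c"
    by (auto simp: eventually_sequentially intro: less_imp_le)
  obtain B where B: "1 \<le> B" "\<And>t. z t \<le> B"
  proof (rule recursion_bounded[where z=z and T="max T T1" and c=c and \<alpha>=\<alpha>
        and \<delta>="\<lambda>t. D * (real t + 3) powr (- (\<nu> - 1/4))"])
    show "z (Suc t) \<le> (1 - c * \<alpha> t) * z t + \<alpha> t * (D * (real t + 3) powr (- (\<nu> - 1/4))) * B"
      if "max T T1 \<le> t" "1 \<le> B" "\<And>s. s \<le> t \<Longrightarrow> z s \<le> B" for t B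
      using that by (intro D(3)) auto
    show "0 \<le> \<alpha> t \<and> c * \<alpha> t \<le> 1 \<and> D * (real t + 3) powr (- (\<nu> - 1/4)) \<le> c" if "max T T1 \<le> t" for t
      using that T1 c\<alpha> \<alpha>_pos[of t] by auto
  qed (rule that)
  have "eventually (\<lambda>t. r \<le> c / 2 * \<alpha> t * (real t + 3)) sequentially"
  proof (cases "\<nu> < 1")
    case True
    have "filterlim (\<lambda>t. c / 2 * \<alpha> t * (real t + 3)) at_top sequentially"
      unfolding \<alpha> using True c(1) C by real_asymp
    then show ?thesis by (simp add: filterlim_at_top)
  next
    case False
    then have \<nu>1: "\<nu> = 1" using \<nu> by simp
    have "\<alpha> t * (real t + 3) = C" for t by (simp add: \<alpha> \<nu>1)
    then have eq: "c / 2 * \<alpha> t * (real t + 3) = c / 2 * C" for t by (simp only: mult.assoc)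
    have "r \<le> c / 2 * C" using r(3) \<nu>1 by simp
    then show ?thesis unfolding eq by (rule always_eventually[OF allI])
  qed
  then obtain T2 where T2: "\<And>t. T2 \<le> t \<Longrightarrow> r \<le> c / 2 * \<alpha> t * (real t + 3)"
    by (auto simp: eventually_sequentially)
  obtain D' where D': "0 \<le> D'" "\<And>t. z t \<le> D' * (real t + 3) powr (- r)"
  proof (rule recursion_rate[where z=z and T="max T T2" and c=c and \<alpha>=\<alpha> and C="D * B" and r=r])
    fix t assume t: "max T T2 \<le> t"
    have "z (Suc t) \<le> (1 - c * \<alpha> t) * z t + \<alpha> t * (D * (real t + 3) powr (- (\<nu> - 1/4))) * B"
      using t B by (intro D(3)) auto
    also have "\<alpha> t * (D * (real t + 3) powr (- (\<nu> - 1/4))) * B \<le> \<alpha> t * (D * (real t + 3) powr (- r)) * B"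
      using D(1) B(1) \<alpha>_pos[of t] r by (intro mult_right_mono mult_left_mono powr_mono) auto
    also have "\<dots> = D * B * \<alpha> t * (real t + 3) powr (- r)" by simp
    finally show "z (Suc t) \<le> (1 - c * \<alpha> t) * z t + D * B * \<alpha> t * (real t + 3) powr (- r)" by simp
    show "0 \<le> \<alpha> t \<and> c * \<alpha> t \<le> 1 \<and> r \<le> c / 2 * \<alpha> t * (real t + 3)"
      using t c\<alpha>[of t] T2[of t] \<alpha>_pos[of t] by auto
  qed (use r c in auto)
  show ?thesis
  proof (rule that[of "(2 * n\<^sub>2\<^sup>2 + 2) * D'"])
    fix t
    have "(2 * n\<^sub>2\<^sup>2 + 2) * z t \<le> (2 * n\<^sub>2\<^sup>2 + 2) * (D' * (real t + 3) powr (- r))"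
      by (intro mult_left_mono D') auto
    then show "expectation (\<lambda>\<omega>. (norm (w t \<omega> - ws))\<^sup>2) \<le> (2 * n\<^sub>2\<^sup>2 + 2) * D' * (real t + 3) powr (- r)"
      using error_le_z[of t] by simp
  qed (use D' in simp)
qed

section \<open>Almost sure rates\<close>

lemma almost_sure_rate:
  assumes r: "0 \<le> r" "r \<le> \<nu> - 1/4" "\<nu> < 1 \<or> r \<le> c / 2 * C"
    and \<zeta>: "0 < \<zeta>" "3 / 2 * \<zeta> < \<nu> + r - 1"
  shows "AE \<omega> in M. (\<lambda>t. real t powr \<zeta> * (norm (w t \<omega> - ws))\<^sup>2) \<longlonglongrightarrow> 0"
proof -
  obtain D where D: "0 \<le> D" "\<And>t. expectation (\<lambda>\<omega>. (norm (w t \<omega> - ws))\<^sup>2) \<le> D * (real t + 3) powr (- r)"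
    by (rule mean_square_rate[OF r]) (rule that)
  define g where "g = ((1 - r + \<zeta>) + (\<nu> - \<zeta> / 2)) / 2"
  have g: "1 - r + \<zeta> < g" "g < \<nu> - \<zeta> / 2" using \<zeta> by (auto simp: g_def field_simps)
  have "AE \<omega> in M. summable (\<lambda>t. (real t + 3) powr (\<zeta> - g) * (norm (w t \<omega> - ws))\<^sup>2)"
  proof (rule AE_summable_of_integral_bound)
    show "integrable M (\<lambda>\<omega>. (real t + 3) powr (\<zeta> - g) * (norm (w t \<omega> - ws))\<^sup>2)" for t
      by (intro bounded_rv_integrable rv_intros)
    show "expectation (\<lambda>\<omega>. (real t + 3) powr (\<zeta> - g) * (norm (w t \<omega> - ws))\<^sup>2) \<le> D * (real t + 3) powr (\<zeta> - g - r)" for t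
      using mult_left_mono[OF D(2)[of t], of "(real t + 3) powr (\<zeta> - g)"]
      by (simp add: powr_add[symmetric] mult.left_commute)
    have "summable (\<lambda>t. real t powr (\<zeta> - g - r))"
      using g by (simp add: summable_real_powr_iff)
    then have "summable (\<lambda>t. real (t + 3) powr (\<zeta> - g - r))"
      by (rule summable_ignore_initial_segment)
    then show "summable (\<lambda>t. D * (real t + 3) powr (\<zeta> - g - r))"
      by (intro summable_mult) (simp add: add.commute)
  qed auto
  moreover have "AE \<omega> in M. \<omega> \<in> space M" by simp
  ultimately show ?thesis
  proof eventually_elim
    case (elim \<omega>)
    let ?L = "(L + 1) * (1 + norm ws)"
    show ?case
    proof (rule weighted_summable_imp_rate[where \<alpha>=\<alpha> and C=C and \<nu>=\<nu> and g=g and L="?L"])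
      fix t
      let ?e = "norm (w t \<omega> - ws)"
      have nw: "norm (w t \<omega>) \<le> norm ws + ?e" using norm_triangle_ineq[of ws "w t \<omega> - ws"] by simp
      have "norm (H (w t \<omega>) (Y (Suc t) \<omega>) - w t \<omega>) \<le> L * (1 + norm (w t \<omega>)) + norm (w t \<omega>)"
        using norm_triangle_ineq4[of "H (w t \<omega>) (Y (Suc t) \<omega>)" "w t \<omega>"]
          H_bound[OF Y_space[OF elim(2)], of "w t \<omega>" "Suc t"] by linarith
      also have "\<dots> \<le> (L + 1) * (1 + norm (w t \<omega>))" by (simp add: algebra_simps)
      also have "\<dots> \<le> (L + 1) * ((1 + norm ws) * (1 + ?e))"
      proof (rule mult_left_mono)
        have "(1 + norm ws) * (1 + ?e) = 1 + (norm ws + ?e) + norm ws * ?e" by (simp add: algebra_simps)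
        moreover have "0 \<le> norm ws * ?e" by simp
        ultimately show "1 + norm (w t \<omega>) \<le> (1 + norm ws) * (1 + ?e)" using nw by linarith
      qed (use L in simp)
      finally have "\<alpha> t * norm (H (w t \<omega>) (Y (Suc t) \<omega>) - w t \<omega>) \<le> \<alpha> t * (?L * (1 + ?e))"
        using \<alpha>_pos[of t] by (intro mult_left_mono) (auto simp: mult.assoc)
      moreover have "norm (w (Suc t) \<omega> - ws) \<le> ?e + \<alpha> t * norm (H (w t \<omega>) (Y (Suc t) \<omega>) - w t \<omega>)"
        using norm_triangle_ineq[of "w t \<omega> - ws" "\<alpha> t *\<^sub>R (H (w t \<omega>) (Y (Suc t) \<omega>) - w t \<omega>)"] \<alpha>_pos[of t]
        by (simp add: w_Suc add_diff_eq[symmetric] diff_add_eq)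
      ultimately show "norm (w (Suc t) \<omega> - ws) \<le> ?e + \<alpha> t * (?L * (1 + ?e))" by linarith
    qed (use \<alpha> C g \<zeta> r \<nu> L elim in auto)
  qed
qed

lemma almost_sure_rate_N:
  assumes r: "0 \<le> r" "r \<le> \<nu> - 1/4" "\<nu> < 1 \<or> r \<le> c / 2 * C"
    and \<zeta>: "0 < \<zeta>" "3 / 2 * \<zeta> < \<nu> + r - 1"
  shows "AE \<omega> in M. (\<lambda>t. real t powr \<zeta> * (N (w t \<omega> - ws))\<^sup>2) \<longlonglongrightarrow> 0"
  using almost_sure_rate[OF assms]
proof eventually_elim
  case (elim \<omega>)
  have lim: "(\<lambda>t. n\<^sub>1\<^sup>2 * (real t powr \<zeta> * (norm (w t \<omega> - ws))\<^sup>2)) \<longlonglongrightarrow> 0"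
    using tendsto_mult_left[OF elim, of "n\<^sub>1\<^sup>2"] by simp
  have bound: "real t powr \<zeta> * (N (w t \<omega> - ws))\<^sup>2 \<le> n\<^sub>1\<^sup>2 * (real t powr \<zeta> * (norm (w t \<omega> - ws))\<^sup>2)" for t
  proof -
    have "(N (w t \<omega> - ws))\<^sup>2 \<le> (n\<^sub>1 * norm (w t \<omega> - ws))\<^sup>2"
      by (intro power_mono n\<^sub>1 is_norm_nonneg[OF N])
    then have "real t powr \<zeta> * (N (w t \<omega> - ws))\<^sup>2 \<le> real t powr \<zeta> * (n\<^sub>1 * norm (w t \<omega> - ws))\<^sup>2"
      by (intro mult_left_mono) auto
    also have "\<dots> = n\<^sub>1\<^sup>2 * (real t powr \<zeta> * (norm (w t \<omega> - ws))\<^sup>2)"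
      by (simp add: power_mult_distrib)
    finally show ?thesis .
  qed
  show ?case
    by (rule tendsto_sandwich[OF _ _ tendsto_const lim]) (auto intro!: always_eventually bound)
qed

end

theorem theorem1:
  fixes M :: "'a measure" and S :: "'y measure" and K :: "'y \<Rightarrow> 'y measure"
    and Y :: "nat \<Rightarrow> 'a \<Rightarrow> 'y" and dY :: "'y measure"
    and H :: "real^'d \<Rightarrow> 'y \<Rightarrow> real^'d" and h :: "real^'d \<Rightarrow> real^'d"
    and N :: "real^'d \<Rightarrow> real"
    and w :: "nat \<Rightarrow> 'a \<Rightarrow> real^'d" and w0 wstar :: "real^'d"
    and \<alpha> :: "nat \<Rightarrow> real" and C\<alpha> \<nu> :: real
  assumes MC: "markov_chain M S K Y"
    and stat: "stationary S K dY"
    and stat_unique: "\<And>d'. stationary S K d' \<Longrightarrow> d' = dY"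
    and A1: "\<exists>CA \<rho>. 0 \<le> \<rho> \<and> \<rho> < 1 \<and>
               (\<forall>y\<in>space S. \<forall>n. \<forall>A\<in>sets S. \<bar>kernel_pow K n y A - measure dY A\<bar> \<le> CA * \<rho> ^ n)"
    and H_meas: "\<And>v. H v \<in> borel_measurable S"
    and h_def: "\<And>v. h v = (\<integral>y. H v y \<partial>dY)"
    and N_norm: "is_norm N"
    and A2: "\<exists>\<kappa>. 0 \<le> \<kappa> \<and> \<kappa> < 1 \<and> (\<forall>v v'. N (h v - h v') \<le> \<kappa> * N (v - v'))"
    and A3: "\<exists>L. \<forall>v v'. \<forall>y\<in>space S. N (H v y - H v' y) \<le> L * N (v - v')"
    and A3': "\<exists>B. \<forall>y\<in>space S. N (H 0 y) \<le> B"
    and fix_pt: "h wstar = wstar"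
    and \<alpha>_def: "\<And>t. \<alpha> t = C\<alpha> / (real t + 3) powr \<nu>"
    and C\<alpha>_pos: "C\<alpha> > 0"
    and \<nu>_range: "2/3 < \<nu>" "\<nu> \<le> 1"
    and w_init: "\<And>\<omega>. w 0 \<omega> = w0"
    and w_step: "\<And>t \<omega>. w (Suc t) \<omega> = w t \<omega> + \<alpha> t *\<^sub>R (H (w t \<omega>) (Y (Suc t) \<omega>) - w t \<omega>)"
  shows "(\<nu> < 1 \<longrightarrow> (\<forall>\<zeta>. 0 < \<zeta> \<and> \<zeta> < 3/2 * \<nu> - 1 \<longrightarrow>
            (AE \<omega> in M. (\<lambda>t. real t powr \<zeta> * (N (w t \<omega> - wstar))\<^sup>2) \<longlonglongrightarrow> 0)))
       \<and> (\<nu> = 1 \<longrightarrow> (\<forall>\<zeta> \<nu>\<^sub>1. 0 < \<zeta> \<and> \<zeta> < 1 \<and> 0 < \<nu>\<^sub>1 \<longrightarrow>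
            (AE \<omega> in M. (\<lambda>t. exp (\<zeta> * ln (real t) powr (1 / (1 + \<nu>\<^sub>1))) * (N (w t \<omega> - wstar))\<^sup>2)
                \<longlonglongrightarrow> 0)))"
proof -
  obtain CA \<rho> where \<rho>: "0 \<le> \<rho>" "\<rho> < 1"
    and mix: "\<And>y n A. y \<in> space S \<Longrightarrow> A \<in> sets S \<Longrightarrow> \<bar>kernel_pow K n y A - measure dY A\<bar> \<le> CA * \<rho> ^ n"
    using A1 by metis
  obtain \<kappa> where \<kappa>: "0 \<le> \<kappa>" "\<kappa> < 1" "\<And>v v'. N (h v - h v') \<le> \<kappa> * N (v - v')"
    using A2 by metis
  obtain L where L: "\<And>v v' y. y \<in> space S \<Longrightarrow> N (H v y - H v' y) \<le> L * N (v - v')"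
    using A3 by metis
  obtain B where B: "\<And>y. y \<in> space S \<Longrightarrow> N (H 0 y) \<le> B"
    using A3' by metis
  obtain a b where ab: "0 < a" "0 < b" "\<And>x. N x \<le> a * norm x" "\<And>x. norm x \<le> b * N x"
    by (rule is_norm_equivalent[OF N_norm]) (rule that)
  define L' where "L' = b * (\<bar>L\<bar> * a) + b * \<bar>B\<bar>"
  have L'_nonneg: "0 \<le> L'" "0 \<le> b * \<bar>B\<bar>" "0 \<le> b * (\<bar>L\<bar> * a)" using ab by (auto simp: L'_def)
  have lip: "norm (H v y - H v' y) \<le> b * (\<bar>L\<bar> * a) * norm (v - v')" if "y \<in> space S" for v v' y
  proof -
    have "N (H v y - H v' y) \<le> \<bar>L\<bar> * N (v - v')"
      using L[OF that, of v v'] mult_right_mono[OF abs_ge_self[of L] is_norm_nonneg[OF N_norm, of "v - v'"]]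
      by linarith
    also have "\<dots> \<le> \<bar>L\<bar> * (a * norm (v - v'))" by (intro mult_left_mono ab) auto
    finally have "b * N (H v y - H v' y) \<le> b * (\<bar>L\<bar> * (a * norm (v - v')))"
      using ab by (intro mult_left_mono) auto
    then show ?thesis using ab(4)[of "H v y - H v' y"] by (simp add: mult.assoc)
  qed
  have bound0: "norm (H 0 y) \<le> b * \<bar>B\<bar>" if "y \<in> space S" for y
  proof -
    have "b * N (H 0 y) \<le> b * \<bar>B\<bar>" using B[OF that] ab by (intro mult_left_mono) auto
    then show ?thesis using ab(4)[of "H 0 y"] by linarith
  qed
  have d: "prob_space dY" "sets dY = sets S" using stat by (auto simp: stationary_def)
  have \<rho>': "0 < max \<rho> (1/2)" "max \<rho> (1/2) < 1" using \<rho> by auto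
  have \<nu>4: "1/4 < \<nu>" using \<nu>_range by simp
  interpret sa: markov_contraction M S K Y dY H h N w w0 wstar \<alpha> C\<alpha> \<nu> "max \<rho> (1/2)" "\<bar>CA\<bar>" \<kappa> L' a b
  proof (rule markov_contraction.intro)
    show "\<bar>kernel_pow K n y A - measure dY A\<bar> \<le> \<bar>CA\<bar> * max \<rho> (1/2) ^ n"
      if "y \<in> space S" "A \<in> sets S" for y n A
    proof -
      have "CA * \<rho> ^ n \<le> \<bar>CA\<bar> * max \<rho> (1/2) ^ n"
        using \<rho> by (intro mult_mono power_mono) auto
      then show ?thesis using mix[OF that, of n] by linarith
    qed
    show "norm (H v y - H v' y) \<le> L' * norm (v - v')" if "y \<in> space S" for v v' y
    proof -
      have "b * (\<bar>L\<bar> * a) * norm (v - v') \<le> L' * norm (v - v')"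
        using L'_nonneg by (intro mult_right_mono) (auto simp: L'_def)
      then show ?thesis using lip[OF that, of v v'] by linarith
    qed
    show "norm (H v y) \<le> L' * (1 + norm v)" if "y \<in> space S" for v y
    proof -
      have "norm (H v y) \<le> norm (H 0 y) + norm (H v y - H 0 y)"
        using norm_triangle_ineq[of "H 0 y" "H v y - H 0 y"] by simp
      also have "\<dots> \<le> b * \<bar>B\<bar> + b * (\<bar>L\<bar> * a) * norm v"
        using lip[OF that, of v 0] bound0[OF that] by simp
      also have "\<dots> \<le> L' * 1 + L' * norm v"
        using L'_nonneg by (intro add_mono mult_right_mono) (auto simp: L'_def)
      finally show ?thesis by (simp add: distrib_left)
    qed
  qed (fact MC d \<rho>' abs_ge_zero H_meas h_def N_norm ab ab(1,2)[THEN less_imp_le] \<kappa> L'_nonneg fix_pt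
        \<alpha>_def C\<alpha>_pos \<nu>_range \<nu>4 w_init w_step)+
  show ?thesis
  proof (intro conjI impI allI)
    fix \<zeta> assume \<nu>: "\<nu> < 1" and \<zeta>: "0 < \<zeta> \<and> \<zeta> < 3/2 * \<nu> - 1"
    show "AE \<omega> in M. (\<lambda>t. real t powr \<zeta> * (N (w t \<omega> - wstar))\<^sup>2) \<longlonglongrightarrow> 0"
      using \<nu> \<zeta> \<nu>_range by (intro sa.almost_sure_rate_N[of "\<nu> - 1/4"]) auto
  next
    fix \<zeta> \<nu>\<^sub>1 :: real assume \<nu>: "\<nu> = 1" and \<zeta>: "0 < \<zeta> \<and> \<zeta> < 1 \<and> 0 < \<nu>\<^sub>1"
    define r where "r = min (3/4) (sa.c / 2 * C\<alpha>)"
    have r: "0 < r" "r \<le> 3/4" "r \<le> sa.c / 2 * C\<alpha>" using sa.c(1) C\<alpha>_pos by (auto simp: r_def)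
    have "AE \<omega> in M. (\<lambda>t. real t powr (r / 3) * (N (w t \<omega> - wstar))\<^sup>2) \<longlonglongrightarrow> 0"
      using \<nu> r by (intro sa.almost_sure_rate_N[of r]) auto
    then show "AE \<omega> in M. (\<lambda>t. exp (\<zeta> * ln (real t) powr (1 / (1 + \<nu>\<^sub>1))) * (N (w t \<omega> - wstar))\<^sup>2) \<longlonglongrightarrow> 0"
    proof eventually_elim
      case (elim \<omega>)
      have "eventually (\<lambda>t::nat. exp (\<zeta> * ln (real t) powr (1 / (1 + \<nu>\<^sub>1))) \<le> real t powr (r / 3)) sequentially"
        using \<zeta> r by (intro exp_ln_powr_le_powr) auto
      then have "eventually (\<lambda>t. exp (\<zeta> * ln (real t) powr (1 / (1 + \<nu>\<^sub>1))) * (N (w t \<omega> - wstar))\<^sup>2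
          \<le> real t powr (r / 3) * (N (w t \<omega> - wstar))\<^sup>2) sequentially"
        by eventually_elim (intro mult_right_mono, auto)
      then show ?case
        by (intro tendsto_sandwich[OF _ _ tendsto_const elim]) auto
    qed
  qed
qed

end
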